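(* Let $p$ be an odd prime. With the modules $\mathcal M_i$ and maps $d_i,h_i$ defined in the context, the sequence $$0\longrightarrow \mathcal M_1\stackrel{d_1}{\longrightarrow}\mathcal M_2\stackrel{d_2}{\longrightarrow}\mathcal M_3\stackrel{d_3}{\longrightarrow}\mathcal M_4\longrightarrow 0$$ is exact; the map $h_3$ is well-defined; all the $d_i$ and $h_i$ are $G$-module maps; and the $h_i$ satisfy the homotopy condition with multiplication by $p$, that is $$h_1\circ d_1=p,\qquad d_1\circ h_1+h_2\circ d_2=p,\qquad d_2\circ h_2+h_3\circ d_3=p,\qquad d_3\circ h_3=p .$$ Moreover $\mathcal M_1,\mathcal M_2,\mathcal M_3,\mathcal M_4$ are free as $\mathbb Z$-modules, of ranks $1$, $p^2+1$, $2p^2+2p$, $p^2+2p$ respectively.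
   Context: Let $p$ be an odd prime and $G=\langle\tau_1,\tau_2\rangle\cong\mathbb Z/p\mathbb Z\oplus\mathbb Z/p\mathbb Z$. Put $t_i=\tau_i-1$ and $T_i=1+\tau_i+\cdots+\tau_i^{p-1}$ in $\mathbb Z[G]$ for $i=1,2$; for $3\le k\le p+1$ put $\tau_k=\tau_1\tau_2^{k-2}$, $t_k=\tau_k-1$, $T_k=\sum_{j=0}^{p-1}\tau_k^j$. Put $T_G=\sum_{g\in G}g$. Define $\mathcal M_1=\mathbb Z[G]\cdot T_G$, $\mathcal M_2=\mathbb Z[G]\oplus\mathbb Z[G]\cdot T_G$, $\mathcal M_3=\mathbb Z[G]\oplus\mathbb Z[G]\oplus\mathbb Z[G]\cdot T_3\oplus\mathbb Z[G]\cdot T_{p+1}$ and, with $d_1(nT_G)=(nT_G,-pnT_G)$ and $d_2(\eta,nT_G)=(-\eta t_1,\,-\eta t_2,\,\eta T_3+nT_G,\,\eta T_{p+1}+nT_G)$, define $\mathcal M_4=\mathrm{cok}(d_2)$ and let $d_3:\mathcal M_3\to\mathcal M_4$ be the projection. Write $[m]$ for the class of $m\in\mathcal M_3$ in $\mathcal M_4$. Fix $\kappa_1,\kappa_2\in\mathbb Z[G]$ with $t_1\kappa_1+t_2\kappa_2+\frac{p-1}{2}T_3+\frac{p-1}{2}T_{p+1}=T_G-p$ (such elements exist). Define $h_1:\mathcal M_2\to\mathcal M_1$, $h_1(\xi,nT_G)=\xi T_G+(p-1)nT_G$; $h_2:\mathcal M_3\to\mathcal M_2$, $h_2(\xi_1,\xi_2,\xi_3T_3,\xi_4T_{p+1})=\bigl(\xi_1\kappa_1+\xi_2\kappa_2-\frac{p-1}{2}\xi_3T_3-\frac{p-1}{2}\xi_4T_{p+1},\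 \xi_3T_3T_G\bigr)$; $h_3:\mathcal M_4\to\mathcal M_3$, $h_3([m])=p\,m-d_2(h_2(m))$. *)

theory Defs
  imports "HOL-Algebra.Module" "HOL-Algebra.AbelCoset" "HOL-Algebra.Free_Abelian_Groups"
    "HOL-Library.Poly_Mapping" "HOL-Computational_Algebra.Primes"
begin

section \<open>Modules over a commutative ring\<close>

definition class_ring_of :: "'r::comm_ring_1 itself \<Rightarrow> 'r ring" where
  "class_ring_of _ = \<lparr>carrier = UNIV, monoid.mult = (*), one = 1, ring.zero = 0, add = (+)\<rparr>"

text \<open>
  The module records below also have ring multiplication fields, which play no role
  for modules and are left unspecified.
\<close>

definition ideal_module :: "'r::comm_ring_1 set \<Rightarrow> ('r, 'r) module" where
  "ideal_module I =
     \<lparr>carrier = I, monoid.mult = undefined, one = undefined, ring.zero = 0, add = (+), smult = (*)\<rparr>"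

definition module_sum :: "('r, 'a) module \<Rightarrow> ('r, 'b) module \<Rightarrow> ('r, 'a \<times> 'b) module"
    (infixr \<open>\<oplus>\<^sub>m\<close> 65) where
  "M \<oplus>\<^sub>m N =
     \<lparr>carrier = carrier M \<times> carrier N, monoid.mult = undefined, one = undefined,
      ring.zero = (\<zero>\<^bsub>M\<^esub>, \<zero>\<^bsub>N\<^esub>),
      add = (\<lambda>(a, b) (c, d). (a \<oplus>\<^bsub>M\<^esub> c, b \<oplus>\<^bsub>N\<^esub> d)),
      smult = (\<lambda>r (a, b). (r \<odot>\<^bsub>M\<^esub> a, r \<odot>\<^bsub>N\<^esub> b))\<rparr>"

definition module_quot :: "('r, 'a) module \<Rightarrow> 'a set \<Rightarrow> ('r, 'a set) module"
    (infixl \<open>Quot\<^sub>m\<close> 65) where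
  "M Quot\<^sub>m N =
     \<lparr>carrier = a_rcosets\<^bsub>M\<^esub> N, monoid.mult = undefined, one = undefined,
      ring.zero = N, add = set_add M,
      smult = (\<lambda>r C. \<Union>x\<in>C. N +>\<^bsub>M\<^esub> (r \<odot>\<^bsub>M\<^esub> x))\<rparr>"

definition module_hom_of :: "'r ring \<Rightarrow> ('r, 'a) module \<Rightarrow> ('r, 'b) module \<Rightarrow> ('a \<Rightarrow> 'b) \<Rightarrow> bool" where
  "module_hom_of R M N f \<longleftrightarrow>
     module R M \<and> module R N \<and> f \<in> carrier M \<rightarrow> carrier N \<and>
     (\<forall>x\<in>carrier M. \<forall>y\<in>carrier M. f (x \<oplus>\<^bsub>M\<^esub> y) = f x \<oplus>\<^bsub>N\<^esub> f y) \<and>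
     (\<forall>r\<in>carrier R. \<forall>x\<in>carrier M. f (r \<odot>\<^bsub>M\<^esub> x) = r \<odot>\<^bsub>N\<^esub> f x)"

definition Z_free_of_rank :: "('r, 'a) module \<Rightarrow> nat \<Rightarrow> bool" where
  "Z_free_of_rank M n \<longleftrightarrow> add_monoid M \<cong> free_Abelian_group {..<n}"


section \<open>The group ring\<close>

text \<open>
  The group is the additive group of a type \<open>'g\<close>; its group ring is the type of finitely
  supported functions with convolution as product, so that the group element \<open>g\<close> becomes
  \<open>Poly_Mapping.single g 1\<close> and the group operation becomes multiplicative there.
\<close>

type_synonym 'g ZG = "'g \<Rightarrow>\<^sub>0 int"

definition type_group :: "'g::ab_group_add monoid" where
  "type_group = \<lparr>carrier = UNIV, monoid.mult = (+), one = 0\<rparr>"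

definition grp :: "'g::ab_group_add \<Rightarrow> 'g ZG" where
  "grp g = Poly_Mapping.single g 1"

definition T_G :: "'g::ab_group_add ZG" where
  "T_G = (\<Sum>g\<in>UNIV. grp g)"

abbreviation Z_G :: "'g::ab_group_add ZG ring" where
  "Z_G \<equiv> class_ring_of TYPE('g ZG)"

context
  fixes p :: nat and \<tau>\<^sub>1 \<tau>\<^sub>2 :: "'g::ab_group_add"
begin

definition tau :: "nat \<Rightarrow> 'g ZG" where
  "tau k = (if k = 1 then grp \<tau>\<^sub>1 else if k = 2 then grp \<tau>\<^sub>2 else grp \<tau>\<^sub>1 * grp \<tau>\<^sub>2 ^ (k - 2))"

definition tk :: "nat \<Rightarrow> 'g ZG" where
  "tk k = tau k - 1"

definition Tk :: "nat \<Rightarrow> 'g ZG" where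
  "Tk k = (\<Sum>j<p. tau k ^ j)"


section \<open>The modules\<close>

definition M1 :: "('g ZG, 'g ZG) module" where
  "M1 = ideal_module (range (\<lambda>r. r * T_G))"

definition M2 :: "('g ZG, 'g ZG \<times> 'g ZG) module" where
  "M2 = ideal_module UNIV \<oplus>\<^sub>m ideal_module (range (\<lambda>r. r * T_G))"

definition M3 :: "('g ZG, 'g ZG \<times> 'g ZG \<times> 'g ZG \<times> 'g ZG) module" where
  "M3 = ideal_module UNIV \<oplus>\<^sub>m ideal_module UNIV \<oplus>\<^sub>m
        ideal_module (range (\<lambda>r. r * Tk 3)) \<oplus>\<^sub>m ideal_module (range (\<lambda>r. r * Tk (p + 1)))"

text \<open>
  In the maps below \<open>x\<close> stands for the element \<open>n T\<^sub>G\<close>, and \<open>x\<^sub>3\<close>, \<open>x\<^sub>4\<close> stand for the elements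
  \<open>\<xi>\<^sub>3 T\<^sub>3\<close>, \<open>\<xi>\<^sub>4 T\<^bsub>p+1\<^esub>\<close> (not for the coefficients).
\<close>

definition d1 :: "'g ZG \<Rightarrow> 'g ZG \<times> 'g ZG" where
  "d1 x = (x, - (of_nat p * x))"

definition d2 :: "'g ZG \<times> 'g ZG \<Rightarrow> 'g ZG \<times> 'g ZG \<times> 'g ZG \<times> 'g ZG" where
  "d2 = (\<lambda>(\<eta>, x). (- \<eta> * tk 1, - \<eta> * tk 2, \<eta> * Tk 3 + x, \<eta> * Tk (p + 1) + x))"

definition M4 :: "('g ZG, ('g ZG \<times> 'g ZG \<times> 'g ZG \<times> 'g ZG) set) module" where
  "M4 = M3 Quot\<^sub>m (d2 ` carrier M2)"

definition d3 :: "'g ZG \<times> 'g ZG \<times> 'g ZG \<times> 'g ZG \<Rightarrow> ('g ZG \<times> 'g ZG \<times> 'g ZG \<times> 'g ZG) set" where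
  "d3 m = (d2 ` carrier M2) +>\<^bsub>M3\<^esub> m"

definition h1 :: "'g ZG \<times> 'g ZG \<Rightarrow> 'g ZG" where
  "h1 = (\<lambda>(\<xi>, x). \<xi> * T_G + of_nat (p - 1) * x)"

definition kappa_rel :: "'g ZG \<Rightarrow> 'g ZG \<Rightarrow> bool" where
  "kappa_rel \<kappa>\<^sub>1 \<kappa>\<^sub>2 \<longleftrightarrow>
     tk 1 * \<kappa>\<^sub>1 + tk 2 * \<kappa>\<^sub>2 + of_nat ((p - 1) div 2) * Tk 3 + of_nat ((p - 1) div 2) * Tk (p + 1)
       = T_G - of_nat p"

definition h2 :: "'g ZG \<Rightarrow> 'g ZG \<Rightarrow> 'g ZG \<times> 'g ZG \<times> 'g ZG \<times> 'g ZG \<Rightarrow> 'g ZG \<times> 'g ZG" where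
  "h2 \<kappa>\<^sub>1 \<kappa>\<^sub>2 = (\<lambda>(\<xi>\<^sub>1, \<xi>\<^sub>2, x\<^sub>3, x\<^sub>4).
     (\<xi>\<^sub>1 * \<kappa>\<^sub>1 + \<xi>\<^sub>2 * \<kappa>\<^sub>2 - of_nat ((p - 1) div 2) * x\<^sub>3 - of_nat ((p - 1) div 2) * x\<^sub>4, x\<^sub>3 * T_G))"

definition h3_rep :: "'g ZG \<Rightarrow> 'g ZG \<Rightarrow> 'g ZG \<times> 'g ZG \<times> 'g ZG \<times> 'g ZG \<Rightarrow> 'g ZG \<times> 'g ZG \<times> 'g ZG \<times> 'g ZG" where
  "h3_rep \<kappa>\<^sub>1 \<kappa>\<^sub>2 m = [p] \<cdot>\<^bsub>M3\<^esub> m \<ominus>\<^bsub>M3\<^esub> d2 (h2 \<kappa>\<^sub>1 \<kappa>\<^sub>2 m)"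

text \<open>The value on a coset is the common value of \<open>h3_rep\<close> on its members, if there is one.\<close>

definition h3 :: "'g ZG \<Rightarrow> 'g ZG \<Rightarrow> ('g ZG \<times> 'g ZG \<times> 'g ZG \<times> 'g ZG) set \<Rightarrow> 'g ZG \<times> 'g ZG \<times> 'g ZG \<times> 'g ZG" where
  "h3 \<kappa>\<^sub>1 \<kappa>\<^sub>2 C = the_elem (h3_rep \<kappa>\<^sub>1 \<kappa>\<^sub>2 ` C)"

end

text \<open>Suitable elements \<open>\<kappa>\<^sub>1\<close>, \<open>\<kappa>\<^sub>2\<close> exist.\<close>

lemma ex_kappa_rel:
  fixes \<tau>\<^sub>1 \<tau>\<^sub>2 :: "'g::ab_group_add"
  assumes p: "prime p" "odd p"
    and iso: "(type_group :: 'g monoid) \<cong> integer_mod_group p \<times>\<times> integer_mod_group p"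
    and gen: "generate type_group {\<tau>\<^sub>1, \<tau>\<^sub>2} = (UNIV :: 'g set)"
  shows "\<exists>\<kappa>\<^sub>1 \<kappa>\<^sub>2. kappa_rel p \<tau>\<^sub>1 \<tau>\<^sub>2 \<kappa>\<^sub>1 \<kappa>\<^sub>2"
proof -
  let ?t1 = "grp \<tau>\<^sub>1 - 1" and ?t2 = "grp \<tau>\<^sub>2 - 1"
  define cng where "cng x y \<longleftrightarrow> (\<exists>a b. x - y = ?t1 * a + ?t2 * b)" for x y :: "'g ZG"
  have grp_add: "grp (g + h) = grp g * grp h" for g h :: 'g
    by (simp add: grp_def mult_single)
  have grp_0: "grp (0 :: 'g) = 1"
    by (simp add: grp_def)
  have cng_refl: "cng x x" for x
    unfolding cng_def by (rule exI[of _ 0], rule exI[of _ 0]) simp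
  have cng_add: "cng (x + x') (y + y')" if xy: "cng x y" "cng x' y'" for x y x' y'
  proof -
    obtain a b a' b' where "x - y = ?t1 * a + ?t2 * b" "x' - y' = ?t1 * a' + ?t2 * b'"
      using xy unfolding cng_def by blast
    moreover have "x + x' - (y + y') = (x - y) + (x' - y')"
      by simp
    ultimately have "x + x' - (y + y') = ?t1 * (a + a') + ?t2 * (b + b')"
      by (simp only: distrib_left add_ac)
    then show ?thesis unfolding cng_def by blast
  qed
  have cng_mult: "cng (z * x) (z * y)" if xy: "cng x y" for x y z
  proof -
    obtain a b where "x - y = ?t1 * a + ?t2 * b"
      using xy unfolding cng_def by blast
    then have "z * (x - y) = ?t1 * (z * a) + ?t2 * (z * b)"
      by (simp add: distrib_left mult.left_commute)
    then show ?thesis unfolding cng_def right_diff_distrib by blast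
  qed
  have cng_trans: "cng x z" if "cng x y" "cng y z" for x y z
  proof -
    have "x + y - (y + z) = x - z" by simp
    then show ?thesis using cng_add[OF that] unfolding cng_def by metis
  qed
  have cng_unit: "cng (x * y) 1" if "cng x 1" "cng y 1" for x y
    using cng_trans[OF cng_mult[OF that(2), of x]] that(1) by simp
  have gen1: "cng (grp \<tau>\<^sub>1) 1"
    unfolding cng_def by (rule exI[of _ 1], rule exI[of _ 0]) simp
  have gen2: "cng (grp \<tau>\<^sub>2) 1"
    unfolding cng_def by (rule exI[of _ 0], rule exI[of _ 1]) simp
  have inv_tg: "inv\<^bsub>type_group\<^esub> g = - g" for g :: 'g
    by (auto simp: m_inv_def type_group_def add_eq_0_iff intro!: the_equality)
  have cng_inv: "cng (grp (- g)) 1" if "cng (grp g) 1" for g :: 'g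
  proof -
    have "cng (grp (- g) * grp g) (grp (- g) * 1)" by (rule cng_mult[OF that])
    then have "cng 1 (grp (- g))" by (simp add: grp_add[symmetric] grp_0)
    then have "cng (- 1 * 1) (- 1 * grp (- g))" by (rule cng_mult)
    then have "cng (- 1 * 1 + (1 + grp (- g))) (- 1 * grp (- g) + (1 + grp (- g)))"
      by (rule cng_add[OF _ cng_refl])
    then show ?thesis by simp
  qed
  have cng_grp: "cng (grp g) 1" for g :: 'g
  proof -
    have "g \<in> generate type_group {\<tau>\<^sub>1, \<tau>\<^sub>2}" using gen by simp
    then show ?thesis
    proof (induction rule: generate.induct)
      case one
      then show ?case by (simp add: type_group_def grp_0 cng_refl)
    next
      case (incl h)
      then show ?case using gen1 gen2 by auto
    next
      case (inv h)
      then show ?case using gen1 gen2 cng_inv by (auto simp: inv_tg)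
    next
      case (eng h1 h2)
      then show ?case using cng_unit by (simp add: type_group_def grp_add)
    qed
  qed
  have cng_pow: "cng (x ^ j) 1" if "cng x 1" for x j
    by (induction j) (use that cng_unit cng_refl in auto)
  have cng_sum_g: "cng (\<Sum>i\<in>A. f i) (of_nat (card A))"
    if "finite A" "\<And>i. i \<in> A \<Longrightarrow> cng (f i) 1" for A :: "'g set" and f
    using that
    by (induction A rule: finite_induct) (auto simp: cng_refl intro: cng_add)
  have cng_sum_nat: "cng (\<Sum>i\<in>A. f i) (of_nat (card A))"
    if "finite A" "\<And>i. i \<in> A \<Longrightarrow> cng (f i) 1" for A :: "nat set" and f
    using that
    by (induction A rule: finite_induct) (auto simp: cng_refl intro: cng_add)
  have p0: "p > 0" using p(1) by (simp add: prime_gt_0_nat)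
  obtain f where f: "f \<in> Group.iso (type_group :: 'g monoid) (integer_mod_group p \<times>\<times> integer_mod_group p)"
    using iso unfolding is_iso_def by blast
  then have bij: "bij_betw f (UNIV :: 'g set) ({0..<int p} \<times> {0..<int p})"
    using p0 by (simp add: Group.iso_def type_group_def DirProd_def carrier_integer_mod_group)
  have fin: "finite (UNIV :: 'g set)"
    using bij_betw_finite[OF bij] by simp
  have card: "card (UNIV :: 'g set) = p * p"
    using bij_betw_same_card[OF bij] by (simp add: card_cartesian_product)
  have cng_tau: "cng (tau \<tau>\<^sub>1 \<tau>\<^sub>2 k) 1" for k
    unfolding tau_def using gen1 gen2 cng_pow cng_unit by simp
  have cng_Tk: "cng (Tk p \<tau>\<^sub>1 \<tau>\<^sub>2 k) (of_nat p)" for k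
    unfolding Tk_def using cng_sum_nat[of "{..<p}"] cng_pow[OF cng_tau] by simp
  have cng_TG: "cng (T_G :: 'g ZG) (of_nat (p * p))"
    unfolding T_G_def using cng_sum_g cng_grp fin card by metis
  obtain q where q: "p = 2 * q + 1" using p(2) oddE by blast
  let ?m = "of_nat ((p - 1) div 2) :: 'g ZG"
  have "cng ((T_G :: 'g ZG) + (- ?m) * (Tk p \<tau>\<^sub>1 \<tau>\<^sub>2 3 + Tk p \<tau>\<^sub>1 \<tau>\<^sub>2 (p + 1)))
             (of_nat (p * p) + (- ?m) * (of_nat p + of_nat p))"
    by (intro cng_add cng_TG cng_mult cng_Tk)
  then obtain a b where ab: "((T_G :: 'g ZG) + (- ?m) * (Tk p \<tau>\<^sub>1 \<tau>\<^sub>2 3 + Tk p \<tau>\<^sub>1 \<tau>\<^sub>2 (p + 1)))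
      - (of_nat (p * p) + (- ?m) * (of_nat p + of_nat p)) = ?t1 * a + ?t2 * b"
    unfolding cng_def by blast
  have "of_nat (p * p) + (- ?m) * (of_nat p + of_nat p) = (of_nat p :: 'g ZG)"
    by (simp add: q algebra_simps)
  with ab have "?t1 * a + ?t2 * b + ?m * Tk p \<tau>\<^sub>1 \<tau>\<^sub>2 3 + ?m * Tk p \<tau>\<^sub>1 \<tau>\<^sub>2 (p + 1) = T_G - of_nat p"
    by (simp add: algebra_simps)
  then show ?thesis
    unfolding kappa_rel_def by (auto simp: tk_def tau_def)
qed

end

theory Submission
  imports Defs "HOL-Library.Product_Plus"
begin

text \<open>
  Elements of the group ring are treated as functions on the group. For a generating pair
  \<open>(\<sigma>, \<rho>)\<close> of the group, the ideal generated by \<open>1 + \<sigma> + \<dots> + \<sigma>\<^bsup>p-1\<^esup>\<close> is the set of all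
  \<open>\<sigma>\<close>-invariant functions (\<open>range_cyc\<close>), and such a function is determined by its arbitrary values on
  the subgroup \<open>H\<close> generated by \<open>\<rho>\<close>. In the same way, the multiples of \<open>T_G\<close> are the constant functions.
  Since \<open>(\<tau>\<^sub>1, \<tau>\<^sub>2)\<close>, \<open>(\<tau>\<^sub>3, \<tau>\<^sub>2)\<close> and \<open>(\<tau>\<^bsub>p+1\<^esub>, \<tau>\<^sub>2)\<close> are generating pairs, this describes all the modules
  \<open>M1\<close>, \<open>M2\<close>, \<open>M3\<close> and gives integer coordinates on them.

  Exactness at \<open>M2\<close> holds because \<open>\<eta> (\<tau>\<^sub>1 - 1) = \<eta> (\<tau>\<^sub>2 - 1) = 0\<close> forces \<open>\<eta>\<close> to be constant, and then
  \<open>\<eta> T\<^sub>3 = p \<eta>\<close>; at \<open>M3\<close> and \<open>M4\<close> it holds by the construction of the quotient. The relation between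
  \<open>\<kappa>\<^sub>1\<close> and \<open>\<kappa>\<^sub>2\<close> amounts to \<open>d\<^sub>1 h\<^sub>1 + h\<^sub>2 d\<^sub>2 = p\<close> (\<open>d1_h1_h2_d2\<close>). As \<open>d\<^sub>2 d\<^sub>1 = 0\<close>, it follows that
  \<open>p m - d\<^sub>2 (h\<^sub>2 m)\<close> vanishes for \<open>m\<close> in the image of \<open>d\<^sub>2\<close>, so that \<open>h\<^sub>3\<close> is well-defined, and the last two
  homotopy identities hold by the definition of \<open>h\<^sub>3\<close>.

  The freeness of \<open>M4\<close> is the only part that needs more than these computations. It is shown by an
  explicit complement of the image of \<open>d\<^sub>2\<close> in the group \<open>M3\<close>: the quadruples \<open>(a, b, c, d)\<close> such that
  \<open>a\<close> is supported on the subgroup \<open>H\<close> generated by \<open>\<tau>\<^sub>2\<close>, \<open>b\<close> vanishes on \<open>H\<close> except at the neutral element,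
  and \<open>d\<close> vanishes at the neutral element. Every element can be reduced to this form modulo the image
  of \<open>d\<^sub>2\<close> (\<open>reduce_first\<close>, \<open>reduce_second\<close>) in only one way (\<open>reduced_imp_const\<close>). The complement is
  visibly free, of rank \<open>p + (p\<^sup>2 - (p - 1)) + p + (p - 1) = p\<^sup>2 + 2 p\<close>.
\<close>

section \<open>Coordinates of free abelian groups\<close>

text \<open>
  The functions \<open>c _ i\<close> for \<open>i \<in> I\<close> are coordinates on the set \<open>S\<close>: every integer vector indexed
  by \<open>I\<close> is the coordinate vector of exactly one element of \<open>S\<close>. For a group and additive \<open>c\<close>
  this means that the group is free with a basis indexed by \<open>I\<close>, see \<open>free_of_coords\<close> below.
\<close>
definition has_coords :: "'a set \<Rightarrow> ('a \<Rightarrow> 'i \<Rightarrow> int) \<Rightarrow> 'i set \<Rightarrow> bool" where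
  "has_coords S c I \<longleftrightarrow> (\<forall>v. \<exists>!x. x \<in> S \<and> (\<forall>i\<in>I. c x i = v i))"

lemma has_coords_inj:
  assumes "has_coords S c I" "x \<in> S" "y \<in> S" "\<And>i. i \<in> I \<Longrightarrow> c x i = c y i"
  shows "x = y"
  using assms unfolding has_coords_def by metis

lemma has_coords_surj:
  assumes "has_coords S c I"
  obtains x where "x \<in> S" "\<And>i. i \<in> I \<Longrightarrow> c x i = v i"
  using assms unfolding has_coords_def by metis

lemma has_coordsI:
  assumes "\<And>v. \<exists>x\<in>S. \<forall>i\<in>I. c x i = v i"
    and "\<And>x y. x \<in> S \<Longrightarrow> y \<in> S \<Longrightarrow> (\<And>i. i \<in> I \<Longrightarrow> c x i = c y i) \<Longrightarrow> x = y"
  shows "has_coords S c I"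
  unfolding has_coords_def
proof (intro allI ex_ex1I)
  fix v show "\<exists>x. x \<in> S \<and> (\<forall>i\<in>I. c x i = v i)" using assms(1) by blast
next
  fix v x y
  assume "x \<in> S \<and> (\<forall>i\<in>I. c x i = v i)" "y \<in> S \<and> (\<forall>i\<in>I. c y i = v i)"
  then show "x = y" by (intro assms(2)) auto
qed

lemma has_coords_times:
  fixes I :: "'i set" and I' :: "'j set"
  assumes 1: "has_coords S c I" and 2: "has_coords S' c' I'"
  shows "has_coords (S \<times> S') (\<lambda>(x, y). case_sum (c x) (c' y)) (I <+> I')"
proof (rule has_coordsI)
  fix v :: "'i + 'j \<Rightarrow> int"
  obtain x where x: "x \<in> S" "\<And>i. i \<in> I \<Longrightarrow> c x i = v (Inl i)"
    using has_coords_surj[OF 1, of "\<lambda>i. v (Inl i)"] by blast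
  obtain y where y: "y \<in> S'" "\<And>i. i \<in> I' \<Longrightarrow> c' y i = v (Inr i)"
    using has_coords_surj[OF 2, of "\<lambda>i. v (Inr i)"] by blast
  show "\<exists>z\<in>S \<times> S'. \<forall>i\<in>I <+> I'. (case z of (x, y) \<Rightarrow> case_sum (c x) (c' y)) i = v i"
    using x y by (intro bexI[of _ "(x, y)"]) auto
next
  fix z w
  assume z: "z \<in> S \<times> S'" and w: "w \<in> S \<times> S'"
    and eq: "\<And>i. i \<in> I <+> I' \<Longrightarrow> (case z of (x, y) \<Rightarrow> case_sum (c x) (c' y)) i
      = (case w of (x, y) \<Rightarrow> case_sum (c x) (c' y)) i"
  have "fst z = fst w"
  proof (rule has_coords_inj[OF 1])
    fix i assume "i \<in> I"
    then show "c (fst z) i = c (fst w) i" using eq[of "Inl i"] by (simp add: case_prod_unfold InlI)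
  qed (use z w in auto)
  moreover have "snd z = snd w"
  proof (rule has_coords_inj[OF 2])
    fix i assume "i \<in> I'"
    then show "c' (snd z) i = c' (snd w) i" using eq[of "Inr i"] by (simp add: case_prod_unfold InrI)
  qed (use z w in auto)
  ultimately show "z = w" by (simp add: prod_eq_iff)
qed

lemma free_of_coords:
  assumes G: "group G" and c: "has_coords (carrier G) c I"
    and I: "finite I" "card I = n"
    and add: "\<And>x y i. x \<in> carrier G \<Longrightarrow> y \<in> carrier G \<Longrightarrow> i \<in> I \<Longrightarrow> c (x \<otimes>\<^bsub>G\<^esub> y) i = c x i + c y i"
  shows "G \<cong> free_Abelian_group {..<n}"
proof -
  obtain e where e: "bij_betw e {..<n} I"
    using I ex_bij_betw_nat_finite[of I] by (auto simp: atLeast0LessThan)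
  have eI: "e k \<in> I" if "k < n" for k
    using e that by (auto simp: bij_betw_def)
  define f where "f x = Abs_poly_mapping (\<lambda>k. if k < n then c x (e k) else 0)" for x
  have lf: "Poly_Mapping.lookup (f x) k = (if k < n then c x (e k) else 0)" for x k
    unfolding f_def by (subst Abs_poly_mapping_inverse) (auto intro: finite_subset[of _ "{..<n}"])
  have kf: "Poly_Mapping.keys (f x) \<subseteq> {..<n}" for x
    by (auto simp: in_keys_iff lf split: if_splits)
  have "f \<in> Group.iso G (free_Abelian_group {..<n})"
  proof (rule isoI)
    show "f \<in> hom G (free_Abelian_group {..<n})"
      using kf by (auto simp: hom_def poly_mapping_eq_iff fun_eq_iff lf lookup_add add eI)
    have "inj_on f (carrier G)"
    proof (rule inj_onI)
      fix x y assume xy: "x \<in> carrier G" "y \<in> carrier G" "f x = f y"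
      show "x = y"
      proof (rule has_coords_inj[OF c xy(1,2)])
        fix i assume "i \<in> I"
        then obtain k where "k < n" "i = e k" using e by (auto simp: bij_betw_def)
        then show "c x i = c y i" using lf[of x k] lf[of y k] xy(3) by simp
      qed
    qed
    moreover have "f ` carrier G = carrier (free_Abelian_group {..<n})"
    proof (intro equalityI subsetI)
      fix z assume z: "z \<in> carrier (free_Abelian_group {..<n})"
      obtain x where x: "x \<in> carrier G"
          "\<And>i. i \<in> I \<Longrightarrow> c x i = Poly_Mapping.lookup z (inv_into {..<n} e i)"
        using has_coords_surj[OF c, of "\<lambda>i. Poly_Mapping.lookup z (inv_into {..<n} e i)"] by blast
      have "f x = z"
      proof (rule poly_mapping_eqI)
        fix k
        show "Poly_Mapping.lookup (f x) k = Poly_Mapping.lookup z k"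
          using z x(2)[OF eI, of k] bij_betw_inv_into_left[OF e, of k]
          by (auto simp: lf in_keys_iff)
      qed
      then show "z \<in> f ` carrier G" using x(1) by blast
    qed (use kf in auto)
    ultimately show "bij_betw f (carrier G) (carrier (free_Abelian_group {..<n}))"
      by (simp add: bij_betw_def)
  qed
  then show ?thesis by (rule is_isoI)
qed

section \<open>Modules over a commutative ring\<close>

lemma cring_class_ring_of: "cring (class_ring_of TYPE('r::comm_ring_1))"
proof (rule cringI)
  show "abelian_group (class_ring_of TYPE('r))"
    by (rule abelian_groupI)
      (auto simp: class_ring_of_def algebra_simps intro: exI[of _ "- x" for x])
  show "comm_monoid (class_ring_of TYPE('r))"
    by (rule comm_monoidI) (auto simp: class_ring_of_def algebra_simps)
qed (auto simp: class_ring_of_def algebra_simps)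

lemma class_ring_of_simps [simp]:
  "carrier (class_ring_of TYPE('r::comm_ring_1)) = UNIV"
  "x \<otimes>\<^bsub>class_ring_of TYPE('r)\<^esub> y = x * y"
  "x \<oplus>\<^bsub>class_ring_of TYPE('r)\<^esub> y = x + y"
  "\<one>\<^bsub>class_ring_of TYPE('r)\<^esub> = 1"
  "\<zero>\<^bsub>class_ring_of TYPE('r)\<^esub> = 0"
  by (simp_all add: class_ring_of_def)

lemma ideal_module_simps [simp]:
  "carrier (ideal_module I) = I"
  "x \<oplus>\<^bsub>ideal_module I\<^esub> y = x + y"
  "\<zero>\<^bsub>ideal_module I\<^esub> = 0"
  "r \<odot>\<^bsub>ideal_module I\<^esub> x = r * x"
  by (simp_all add: ideal_module_def)

lemma module_sum_simps [simp]:
  "carrier (M \<oplus>\<^sub>m N) = carrier M \<times> carrier N"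
  "(a, b) \<oplus>\<^bsub>M \<oplus>\<^sub>m N\<^esub> (c, d) = (a \<oplus>\<^bsub>M\<^esub> c, b \<oplus>\<^bsub>N\<^esub> d)"
  "\<zero>\<^bsub>M \<oplus>\<^sub>m N\<^esub> = (\<zero>\<^bsub>M\<^esub>, \<zero>\<^bsub>N\<^esub>)"
  "r \<odot>\<^bsub>M \<oplus>\<^sub>m N\<^esub> (a, b) = (r \<odot>\<^bsub>M\<^esub> a, r \<odot>\<^bsub>N\<^esub> b)"
  by (simp_all add: module_sum_def)

lemma module_ideal_module:
  fixes I :: "'r::comm_ring_1 set"
  assumes "0 \<in> I" and "\<And>x y. x \<in> I \<Longrightarrow> y \<in> I \<Longrightarrow> x + y \<in> I"
    and "\<And>r x. x \<in> I \<Longrightarrow> r * x \<in> I"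
  shows "module (class_ring_of TYPE('r)) (ideal_module I)"
proof (rule moduleI)
  show "abelian_group (ideal_module I)"
  proof (rule abelian_groupI)
    fix x assume "x \<in> carrier (ideal_module I)"
    then show "\<exists>y\<in>carrier (ideal_module I). y \<oplus>\<^bsub>ideal_module I\<^esub> x = \<zero>\<^bsub>ideal_module I\<^esub>"
      using assms(3)[of x "-1"] by (intro bexI[of _ "-x"]) auto
  qed (use assms in \<open>auto simp: algebra_simps\<close>)
qed (use assms in \<open>auto simp: cring_class_ring_of distrib_left distrib_right mult.assoc\<close>)

lemma module_module_sum:
  assumes M: "module R M" and N: "module R N"
  shows "module R (M \<oplus>\<^sub>m N)"
proof -
  interpret M: module R M by fact
  interpret N: module R N by fact
  show ?thesis
  proof (rule moduleI)
    show "abelian_group (M \<oplus>\<^sub>m N)"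
    proof (rule abelian_groupI)
      fix x assume "x \<in> carrier (M \<oplus>\<^sub>m N)"
      then show "\<exists>y\<in>carrier (M \<oplus>\<^sub>m N). y \<oplus>\<^bsub>M \<oplus>\<^sub>m N\<^esub> x = \<zero>\<^bsub>M \<oplus>\<^sub>m N\<^esub>"
        by (intro bexI[of _ "(\<ominus>\<^bsub>M\<^esub> fst x, \<ominus>\<^bsub>N\<^esub> snd x)"])
          (auto simp: M.M.l_neg N.M.l_neg)
    qed (auto simp: M.M.a_ac N.M.a_ac)
  qed (auto simp: M.smult_l_distr N.smult_l_distr M.smult_r_distr N.smult_r_distr
        M.smult_assoc1 N.smult_assoc1 M.R.is_cring)
qed

text \<open>Multiples by natural numbers are scalar multiples by their images in the ring.\<close>
lemma add_pow_eq_smult: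
  assumes "module (class_ring_of TYPE('r::comm_ring_1)) M" and x: "x \<in> carrier M"
  shows "[n] \<cdot>\<^bsub>M\<^esub> x = of_nat n \<odot>\<^bsub>M\<^esub> x"
proof -
  interpret M: module "class_ring_of TYPE('r)" M by fact
  show ?thesis
  proof (induction n)
    case 0
    show ?case using M.smult_l_null[OF x] by simp
  next
    case (Suc n)
    show ?case
      using M.smult_l_distr[of "of_nat n" 1 x] M.smult_one[OF x] x Suc
      by (simp add: M.M.add.nat_pow_Suc add.commute)
  qed
qed

lemma module_quot_add: "X \<oplus>\<^bsub>M Quot\<^sub>m N\<^esub> Y = X <+>\<^bsub>M\<^esub> Y"
  by (simp add: module_quot_def)

text \<open>A module together with a submodule \<open>N\<close>.\<close>
locale quotient_module = M?: module R M for R :: "'r ring" (structure) and M :: "('r, 'c) module" (structure) +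
  fixes N
  assumes subset: "N \<subseteq> carrier M" and zero: "\<zero>\<^bsub>M\<^esub> \<in> N"
    and add: "\<And>x y. x \<in> N \<Longrightarrow> y \<in> N \<Longrightarrow> x \<oplus>\<^bsub>M\<^esub> y \<in> N"
    and smult: "\<And>r x. r \<in> carrier R \<Longrightarrow> x \<in> N \<Longrightarrow> r \<odot>\<^bsub>M\<^esub> x \<in> N"
begin

lemma minus: "x \<in> N \<Longrightarrow> \<ominus>\<^bsub>M\<^esub> x \<in> N"
  using smult[of "\<ominus> \<one>" x] subset smult_l_minus[of \<one> x] by auto

sublocale N: abelian_subgroup N M
proof (rule abelian_subgroupI3)
  show "additive_subgroup N M"
    by (rule additive_subgroupI, rule subgroup.intro)
      (use subset zero add minus in \<open>auto simp: a_inv_def[symmetric]\<close>)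
qed (rule M.abelian_group_axioms)

lemma coset_eq_iff:
  assumes "x \<in> carrier M" "y \<in> carrier M"
  shows "N +>\<^bsub>M\<^esub> x = N +>\<^bsub>M\<^esub> y \<longleftrightarrow> x \<ominus>\<^bsub>M\<^esub> y \<in> N"
proof -
  have "x \<in> N +>\<^bsub>M\<^esub> y \<longleftrightarrow> x \<ominus>\<^bsub>M\<^esub> y \<in> N"
    using N.a_rcos_module[OF assms(2,1)] by (simp add: a_minus_def)
  moreover have "N +>\<^bsub>M\<^esub> x = N +>\<^bsub>M\<^esub> y \<longleftrightarrow> x \<in> N +>\<^bsub>M\<^esub> y"
    using N.a_repr_independenceD[OF assms(1), of y] N.a_repr_independence'[OF _ assms(2), of x] by metis
  ultimately show ?thesis by simp
qed

lemma smult_coset: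
  assumes r: "r \<in> carrier R" and x: "x \<in> carrier M"
  shows "r \<odot>\<^bsub>M Quot\<^sub>m N\<^esub> (N +>\<^bsub>M\<^esub> x) = N +>\<^bsub>M\<^esub> (r \<odot>\<^bsub>M\<^esub> x)"
proof -
  have "N +>\<^bsub>M\<^esub> (r \<odot>\<^bsub>M\<^esub> y) = N +>\<^bsub>M\<^esub> (r \<odot>\<^bsub>M\<^esub> x)" if y: "y \<in> N +>\<^bsub>M\<^esub> x" for y
  proof -
    obtain n where n: "n \<in> N" "y = n \<oplus>\<^bsub>M\<^esub> x"
      using y by (auto simp: a_r_coset_def')
    then have yM: "y \<in> carrier M" using subset x by auto
    have "r \<odot>\<^bsub>M\<^esub> y \<ominus>\<^bsub>M\<^esub> r \<odot>\<^bsub>M\<^esub> x = r \<odot>\<^bsub>M\<^esub> n"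
      using n x r subset by (auto simp: smult_r_distr M.minus_eq M.a_assoc M.r_neg)
    then show ?thesis using coset_eq_iff smult r n yM x by auto
  qed
  moreover have "N +>\<^bsub>M\<^esub> x \<noteq> {}" using N.a_rcos_self[OF x] by blast
  ultimately show ?thesis by (auto simp: module_quot_def)
qed

lemma add_coset:
  "x \<in> carrier M \<Longrightarrow> y \<in> carrier M \<Longrightarrow>
    (N +>\<^bsub>M\<^esub> x) \<oplus>\<^bsub>M Quot\<^sub>m N\<^esub> (N +>\<^bsub>M\<^esub> y) = N +>\<^bsub>M\<^esub> (x \<oplus>\<^bsub>M\<^esub> y)"
  unfolding module_quot_add by (rule N.a_rcos_sum)

lemma carrier_quot: "carrier (M Quot\<^sub>m N) = (\<lambda>x. N +>\<^bsub>M\<^esub> x) ` carrier M"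
  by (auto simp: module_quot_def A_RCOSETS_def')

lemma zero_quot: "\<zero>\<^bsub>M Quot\<^sub>m N\<^esub> = N +>\<^bsub>M\<^esub> \<zero>\<^bsub>M\<^esub>"
  by (simp add: module_quot_def subset)

lemma module_quot: "module R (M Quot\<^sub>m N)"
proof (rule moduleI)
  show "abelian_group (M Quot\<^sub>m N)"
  proof (rule abelian_groupI)
    fix x assume "x \<in> carrier (M Quot\<^sub>m N)"
    then obtain y where y: "y \<in> carrier M" "x = N +>\<^bsub>M\<^esub> y"
      by (auto simp: carrier_quot)
    then show "\<exists>z\<in>carrier (M Quot\<^sub>m N). z \<oplus>\<^bsub>M Quot\<^sub>m N\<^esub> x = \<zero>\<^bsub>M Quot\<^sub>m N\<^esub>"
      by (intro bexI[of _ "N +>\<^bsub>M\<^esub> (\<ominus>\<^bsub>M\<^esub> y)"]) (auto simp: carrier_quot add_coset zero_quot M.l_neg)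
  qed (auto simp: carrier_quot add_coset zero_quot M.a_ac)
qed (auto simp: carrier_quot add_coset smult_coset M.R.is_cring smult_l_distr smult_r_distr smult_assoc1)

lemma module_hom_of_coset: "module_hom_of R M (M Quot\<^sub>m N) (\<lambda>x. N +>\<^bsub>M\<^esub> x)"
  using module_quot M.module_axioms
  by (auto simp: module_hom_of_def carrier_quot add_coset smult_coset)

lemma a_kernel_coset: "a_kernel M (M Quot\<^sub>m N) (\<lambda>x. N +>\<^bsub>M\<^esub> x) = N"
proof -
  have "x \<in> N \<longleftrightarrow> N +>\<^bsub>M\<^esub> x = N" if "x \<in> carrier M" for x
    using N.a_rcos_const[of x] N.a_rcos_self[OF that] by auto
  then show ?thesis
    using subset by (auto simp: a_kernel_def' module_quot_def)
qed

text \<open>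
  If a submodule has a complement \<open>C\<close> as a subgroup, then the quotient is isomorphic to \<open>C\<close>
  as a group, and coordinates on \<open>C\<close> make the quotient free.
\<close>
lemma Z_free_of_rank_quot:
  assumes C: "C \<subseteq> carrier M" "\<And>x y. x \<in> C \<Longrightarrow> y \<in> C \<Longrightarrow> x \<oplus>\<^bsub>M\<^esub> y \<in> C"
    "\<And>x y. x \<in> C \<Longrightarrow> y \<in> C \<Longrightarrow> x \<ominus>\<^bsub>M\<^esub> y \<in> C"
    and inter: "\<And>x. x \<in> C \<Longrightarrow> x \<in> N \<Longrightarrow> x = \<zero>\<^bsub>M\<^esub>"
    and sum: "\<And>x. x \<in> carrier M \<Longrightarrow> \<exists>y\<in>C. x \<ominus>\<^bsub>M\<^esub> y \<in> N"
    and c: "has_coords C c I" "finite I" "card I = n"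
    and c_add: "\<And>x y i. x \<in> C \<Longrightarrow> y \<in> C \<Longrightarrow> i \<in> I \<Longrightarrow> c (x \<oplus>\<^bsub>M\<^esub> y) i = c x i + c y i"
  shows "Z_free_of_rank (M Quot\<^sub>m N) n"
proof -
  interpret Q: module R "M Quot\<^sub>m N" by (rule module_quot)
  define s where "s = inv_into C (\<lambda>x. N +>\<^bsub>M\<^esub> x)"
  have inj: "inj_on (\<lambda>x. N +>\<^bsub>M\<^esub> x) C"
  proof (rule inj_onI)
    fix x y assume xy: "x \<in> C" "y \<in> C" "N +>\<^bsub>M\<^esub> x = N +>\<^bsub>M\<^esub> y"
    then have "x \<ominus>\<^bsub>M\<^esub> y \<in> N" using coset_eq_iff C(1) by blast
    then have "x \<ominus>\<^bsub>M\<^esub> y = \<zero>\<^bsub>M\<^esub>" using inter C(3) xy by blast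
    moreover have xy': "x \<in> carrier M" "y \<in> carrier M" using xy C(1) by auto
    moreover have "x = (x \<ominus>\<^bsub>M\<^esub> y) \<oplus>\<^bsub>M\<^esub> y"
      using xy' by (simp add: a_minus_def M.a_assoc M.l_neg)
    ultimately show "x = y" by simp
  qed
  have img: "(\<lambda>x. N +>\<^bsub>M\<^esub> x) ` C = carrier (M Quot\<^sub>m N)"
  proof (intro equalityI subsetI)
    fix X assume "X \<in> carrier (M Quot\<^sub>m N)"
    then obtain x where x: "x \<in> carrier M" "X = N +>\<^bsub>M\<^esub> x" by (auto simp: carrier_quot)
    obtain y where y: "y \<in> C" "x \<ominus>\<^bsub>M\<^esub> y \<in> N" using sum x by blast
    then have "X = N +>\<^bsub>M\<^esub> y" using coset_eq_iff x C(1) by blast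
    then show "X \<in> (\<lambda>x. N +>\<^bsub>M\<^esub> x) ` C" using y by blast
  qed (use C(1) in \<open>auto simp: carrier_quot\<close>)
  have s: "s X \<in> C" "N +>\<^bsub>M\<^esub> s X = X" if "X \<in> carrier (M Quot\<^sub>m N)" for X
    unfolding s_def using that img
    by (simp_all only: inv_into_into f_inv_into_f[where f = "\<lambda>x. N +>\<^bsub>M\<^esub> x"])
  have s': "s (N +>\<^bsub>M\<^esub> x) = x" if "x \<in> C" for x
    unfolding s_def by (rule inv_into_f_f[OF inj that])
  have s_add: "s (X \<oplus>\<^bsub>M Quot\<^sub>m N\<^esub> Y) = s X \<oplus>\<^bsub>M\<^esub> s Y"
    if "X \<in> carrier (M Quot\<^sub>m N)" "Y \<in> carrier (M Quot\<^sub>m N)" for X Y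
  proof -
    have "X \<oplus>\<^bsub>M Quot\<^sub>m N\<^esub> Y = N +>\<^bsub>M\<^esub> (s X \<oplus>\<^bsub>M\<^esub> s Y)"
      using add_coset[of "s X" "s Y"] s[OF that(1)] s[OF that(2)] C(1) by (metis subsetD)
    then show ?thesis using s'[OF C(2), OF s(1) s(1), OF that] by simp
  qed
  show ?thesis
    unfolding Z_free_of_rank_def
  proof (rule free_of_coords[where c = "\<lambda>X. c (s X)" and I = I])
    show "has_coords (carrier (add_monoid (M Quot\<^sub>m N))) (\<lambda>X. c (s X)) I"
    proof (rule has_coordsI)
      fix v
      obtain x where x: "x \<in> C" "\<And>i. i \<in> I \<Longrightarrow> c x i = v i"
        using has_coords_surj[OF c(1)] by blast
      then show "\<exists>X\<in>carrier (add_monoid (M Quot\<^sub>m N)). \<forall>i\<in>I. c (s X) i = v i"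
        using img C(1) s'[OF x(1)] by (intro bexI[of _ "N +>\<^bsub>M\<^esub> x"]) (auto simp: carrier_quot)
    next
      fix X Y assume XY: "X \<in> carrier (add_monoid (M Quot\<^sub>m N))" "Y \<in> carrier (add_monoid (M Quot\<^sub>m N))"
        "\<And>i. i \<in> I \<Longrightarrow> c (s X) i = c (s Y) i"
      have "s X = s Y"
        by (rule has_coords_inj[OF c(1)]) (use s XY in auto)
      then have "N +>\<^bsub>M\<^esub> s X = N +>\<^bsub>M\<^esub> s Y" by (simp only:)
      then show "X = Y" using XY(1,2) by (simp add: s(2))
    qed
  next
    show "group (add_monoid (M Quot\<^sub>m N))" by (rule Q.M.a_group)
  next
    fix X Y i assume "X \<in> carrier (add_monoid (M Quot\<^sub>m N))" "Y \<in> carrier (add_monoid (M Quot\<^sub>m N))" "i \<in> I"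
    then show "c (s (X \<otimes>\<^bsub>add_monoid (M Quot\<^sub>m N)\<^esub> Y)) i = c (s X) i + c (s Y) i"
      by (simp add: s_add c_add s(1))
  next
    show "finite I" by (rule c(2))
  next
    show "card I = n" by (rule c(3))
  qed
qed

end

section \<open>Two generators of the group\<close>

text \<open>The multiple \<open>n g\<close> of an element of an additively written monoid.\<close>
definition nmul :: "nat \<Rightarrow> 'a::comm_monoid_add \<Rightarrow> 'a" where
  "nmul n g = (\<Sum>i<n. g)"

lemma nmul_0 [simp]: "nmul 0 g = 0"
  and nmul_Suc: "nmul (Suc n) g = nmul n g + g"
  and nmul_1 [simp]: "nmul (Suc 0) g = g"
  and nmul_zero [simp]: "nmul n 0 = 0"
  by (simp_all add: nmul_def)

lemma nmul_add: "nmul (m + n) g = nmul m g + nmul n g"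
  by (induction n) (simp_all add: nmul_Suc add.assoc)

lemma nmul_add_right: "nmul n (g + h) = nmul n g + nmul n h"
  by (simp add: nmul_def sum.distrib)

lemma nmul_mult: "nmul (m * n) g = nmul m (nmul n g)"
  by (induction m) (simp_all add: nmul_Suc nmul_add add.commute)

lemma nmul_mod:
  assumes "nmul p g = 0" shows "nmul (n mod p) g = nmul n g"
proof -
  have "nmul n g = nmul (n div p * p + n mod p) g" by simp
  also have "\<dots> = nmul (n mod p) g" by (simp only: nmul_add nmul_mult assms nmul_zero add_0)
  finally show ?thesis by simp
qed

lemma grp_add: "grp (g + h) = grp g * grp h"
  by (simp add: grp_def mult_single)

lemma grp_0 [simp]: "grp 0 = 1"
  by (simp add: grp_def)

lemma grp_nmul: "grp (nmul n g) = grp g ^ n"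
  by (induction n) (simp_all add: nmul_Suc grp_add)

text \<open>The group ring is generated by the group elements under subtraction.\<close>
lemma group_ring_induct [case_names zero grp diff]:
  fixes x :: "'g::ab_group_add ZG"
  assumes "P 0" "\<And>g. P (grp g)" "\<And>a b. P a \<Longrightarrow> P b \<Longrightarrow> P (a - b)"
  shows "P x"
  by (rule frag_induction[of x UNIV]) (use assms in \<open>auto simp: grp_def\<close>)

lemma lookup_mult_grp [simp]:
  "Poly_Mapping.lookup (x * grp g) h = Poly_Mapping.lookup x (h - g)" for x :: "'g::ab_group_add ZG"
proof (induction x rule: group_ring_induct)
  case (grp a)
  show ?case
    unfolding grp_add[symmetric] by (auto simp: grp_def lookup_single when_def algebra_simps)
qed (simp_all add: left_diff_distrib lookup_minus)

lemma lookup_grp_mult [simp]: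
  "Poly_Mapping.lookup (grp g * x) h = Poly_Mapping.lookup x (h - g)" for x :: "'g::ab_group_add ZG"
  by (subst mult.commute) simp

lemma lookup_of_nat_mult [simp]:
  "Poly_Mapping.lookup (of_nat n * x) h = int n * Poly_Mapping.lookup x h" for x :: "'g::ab_group_add ZG"
  by (induction n) (simp_all add: distrib_right lookup_add)

lemma lookup_of_int_mult [simp]:
  "Poly_Mapping.lookup (of_int n * x) h = n * Poly_Mapping.lookup x h" for x :: "'g::ab_group_add ZG"
  by (cases n rule: int_cases2) simp_all

text \<open>The element \<open>1 + g + \<dots> + g\<^bsup>p-1\<^esup>\<close> of the group ring.\<close>
definition cyc :: "nat \<Rightarrow> 'g::ab_group_add \<Rightarrow> 'g ZG" where
  "cyc p g = (\<Sum>j<p. grp g ^ j)"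

lemma lookup_mult_cyc:
  "Poly_Mapping.lookup (x * cyc p g) h = (\<Sum>j<p. Poly_Mapping.lookup x (h - nmul j g))"
  by (simp add: cyc_def sum_distrib_left lookup_sum grp_nmul[symmetric])

lemma cyc_mult_diff:
  assumes "nmul p g = 0" shows "cyc p g * (grp g - 1) = 0"
proof -
  have "(grp g - 1) * cyc p g = grp g ^ p - 1"
    unfolding cyc_def by (rule power_diff_1_eq[symmetric])
  then show ?thesis using assms by (simp add: grp_nmul[symmetric] mult.commute)
qed

text \<open>
  The elements \<open>\<sigma>\<close> and \<open>\<rho>\<close> of order dividing \<open>p\<close> generate a group of order \<open>p\<^sup>2\<close>; as a consequence
  the group is the direct sum of the cyclic groups generated by \<open>\<sigma>\<close> and by \<open>\<rho>\<close>, both of order \<open>p\<close>.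
\<close>
locale generating_pair =
  fixes p :: nat and \<sigma> \<rho> :: "'g::ab_group_add"
  assumes p_pos: "p > 0"
    and nmul_\<sigma>: "nmul p \<sigma> = 0" and nmul_\<rho>: "nmul p \<rho> = 0"
    and gen: "\<exists>i j. g = nmul i \<sigma> + nmul j \<rho>"
    and card_G: "card (UNIV :: 'g set) = p\<^sup>2"
begin

text \<open>The subgroup generated by \<open>\<rho>\<close>; it is a transversal of the subgroup generated by \<open>\<sigma>\<close>.\<close>
definition H :: "'g set" where
  "H = (\<lambda>j. nmul j \<rho>) ` {..<p}"

lemma finite_G: "finite (UNIV :: 'g set)"
  using card_G p_pos by (intro card_ge_0_finite) simp

lemma surj: "(\<lambda>(i, j). nmul i \<sigma> + nmul j \<rho>) ` ({..<p} \<times> {..<p}) = UNIV"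
proof -
  have "\<exists>x\<in>{..<p} \<times> {..<p}. g = (case x of (i, j) \<Rightarrow> nmul i \<sigma> + nmul j \<rho>)" for g
  proof -
    obtain i j where "g = nmul i \<sigma> + nmul j \<rho>" using gen by blast
    then show ?thesis using p_pos
      by (intro bexI[of _ "(i mod p, j mod p)"]) (auto simp: nmul_mod nmul_\<sigma> nmul_\<rho>)
  qed
  then show ?thesis by blast
qed

lemma inj: "inj_on (\<lambda>(i, j). nmul i \<sigma> + nmul j \<rho>) ({..<p} \<times> {..<p})"
  by (rule eq_card_imp_inj_on) (simp_all add: surj card_G power2_eq_square)

lemma nmul_eq_iff:
  assumes "i < p" "j < p" "i' < p" "j' < p"
  shows "nmul i \<sigma> + nmul j \<rho> = nmul i' \<sigma> + nmul j' \<rho> \<longleftrightarrow> i = i' \<and> j = j'"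
  using inj_onD[OF inj, of "(i, j)" "(i', j')"] assms by auto

lemma card_H: "card H = p"
proof -
  have "inj_on (\<lambda>j. nmul j \<rho>) {..<p}"
    using nmul_eq_iff[of 0 _ 0] p_pos by (auto simp: inj_on_def)
  then show ?thesis by (simp add: H_def card_image)
qed

lemma nmul_\<rho>_H: "nmul j \<rho> \<in> H"
  using nmul_mod[OF nmul_\<rho>, of j] p_pos by (auto simp: H_def intro!: image_eqI[of _ _ "j mod p"])

lemma zero_H: "0 \<in> H"
  using nmul_\<rho>_H[of 0] by simp

lemma H_cases:
  assumes "h \<in> H" obtains j where "j < p" "h = nmul j \<rho>"
  using assms by (auto simp: H_def)

lemma decomp: obtains i h where "i < p" "h \<in> H" "g = nmul i \<sigma> + h"
proof -
  have "g \<in> (\<lambda>(i, j). nmul i \<sigma> + nmul j \<rho>) ` ({..<p} \<times> {..<p})" by (simp add: surj)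
  then show ?thesis using that by (auto simp: H_def)
qed

lemma decomp_unique:
  assumes "h \<in> H" "h' \<in> H" "nmul i \<sigma> + h = nmul i' \<sigma> + h'"
  shows "h = h'" and "i mod p = i' mod p"
proof -
  obtain j j' where j: "j < p" "h = nmul j \<rho>" "j' < p" "h' = nmul j' \<rho>"
    using assms by (meson H_cases)
  then have "nmul (i mod p) \<sigma> + nmul j \<rho> = nmul (i' mod p) \<sigma> + nmul j' \<rho>"
    using assms(3) by (simp add: nmul_mod nmul_\<sigma>)
  then have "i mod p = i' mod p \<and> j = j'"
    using nmul_eq_iff j p_pos by simp
  then show "h = h'" "i mod p = i' mod p" using j by auto
qed

text \<open>The projection of the group onto \<open>H\<close> along the subgroup generated by \<open>\<sigma>\<close>.\<close>
definition proj :: "'g \<Rightarrow> 'g" where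
  "proj g = (THE h. h \<in> H \<and> (\<exists>i. g = nmul i \<sigma> + h))"

lemma proj_eq: "h \<in> H \<Longrightarrow> proj (nmul i \<sigma> + h) = h"
  unfolding proj_def using decomp_unique(1) by (intro the_equality) blast+

lemma proj_H: "h \<in> H \<Longrightarrow> proj h = h"
  using proj_eq[of h 0] by simp

lemma proj_in_H: "proj g \<in> H"
  by (rule decomp[of g]) (simp add: proj_eq)

lemma proj_decomp: "\<exists>i. g = nmul i \<sigma> + proj g"
  by (rule decomp[of g]) (auto simp: proj_eq)

lemma proj_add: "proj (nmul i \<sigma> + g) = proj g"
proof -
  obtain i' h where h: "h \<in> H" "g = nmul i' \<sigma> + h" by (rule decomp)
  then have "nmul i \<sigma> + g = nmul (i + i') \<sigma> + h" by (simp add: nmul_add add.assoc)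
  then show ?thesis using h proj_eq by metis
qed

lemma diff_nmul: "g - nmul j \<sigma> = nmul (p - j) \<sigma> + g" if "j \<le> p"
proof -
  have "nmul (p - j) \<sigma> + nmul j \<sigma> = 0" using that nmul_\<sigma> by (simp add: nmul_add[symmetric])
  then show ?thesis by (simp add: algebra_simps add_eq_0_iff)
qed

lemma diff_notin_H:
  assumes "h \<in> H" "0 < j" "j < p" shows "h - nmul j \<sigma> \<notin> H"
proof
  assume *: "h - nmul j \<sigma> \<in> H"
  have "nmul (p - j) \<sigma> + h = nmul 0 \<sigma> + (h - nmul j \<sigma>)"
    using diff_nmul[of j h] assms by simp
  from decomp_unique(2)[OF assms(1) * this] show False using assms by simp
qed

lemma lookup_mult_cyc_H:
  assumes "h \<in> H" and "\<And>j. 0 < j \<Longrightarrow> j < p \<Longrightarrow> Poly_Mapping.lookup x (h - nmul j \<sigma>) = 0"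
  shows "Poly_Mapping.lookup (x * cyc p \<sigma>) h = Poly_Mapping.lookup x h"
proof -
  have "Poly_Mapping.lookup (x * cyc p \<sigma>) h = (\<Sum>j\<in>{0}. Poly_Mapping.lookup x (h - nmul j \<sigma>))"
    unfolding lookup_mult_cyc using assms p_pos by (intro sum.mono_neutral_right) auto
  then show ?thesis by simp
qed

section \<open>Invariant elements and norm ideals\<close>

text \<open>The elements of the group ring that are invariant under \<open>\<sigma>\<close>.\<close>
definition invs :: "'g ZG set" where
  "invs = {x. grp \<sigma> * x = x}"

lemma invD:
  assumes "x \<in> invs" shows "Poly_Mapping.lookup x (nmul i \<sigma> + g) = Poly_Mapping.lookup x g"
proof (induction i)
  case (Suc i)
  have "grp \<sigma> * x = x" using assms by (simp add: invs_def)
  then have "Poly_Mapping.lookup x (nmul (Suc i) \<sigma> + g)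
      = Poly_Mapping.lookup (grp \<sigma> * x) (nmul (Suc i) \<sigma> + g)" by simp
  also have "\<dots> = Poly_Mapping.lookup x (nmul i \<sigma> + g)"
    by (simp add: nmul_Suc algebra_simps)
  finally show ?case using Suc by simp
qed simp

lemma inv_proj:
  assumes "x \<in> invs" shows "Poly_Mapping.lookup x g = Poly_Mapping.lookup x (proj g)"
  using proj_decomp[of g] invD[OF assms] by metis

lemma inv_eqI:
  assumes "x \<in> invs" "y \<in> invs" "\<And>h. h \<in> H \<Longrightarrow> Poly_Mapping.lookup x h = Poly_Mapping.lookup y h"
  shows "x = y"
  by (rule poly_mapping_eqI) (metis assms inv_proj proj_in_H)

lemma lookup_Abs: "Poly_Mapping.lookup (Abs_poly_mapping v) = v" for v :: "'g \<Rightarrow> int"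
  by (subst Abs_poly_mapping_inverse) (auto intro: finite_subset[OF _ finite_G])

lemma inv_extend: "\<exists>x\<in>invs. \<forall>h\<in>H. Poly_Mapping.lookup x h = v h"
proof (intro bexI ballI)
  let ?x = "Abs_poly_mapping (\<lambda>g. v (proj g))"
  show "Poly_Mapping.lookup ?x h = v h" if "h \<in> H" for h
    using that by (simp add: lookup_Abs proj_H)
  have "proj (g - \<sigma>) = proj g" for g
    using proj_add[of 1 "g - \<sigma>"] by simp
  then show "?x \<in> invs"
    by (auto simp: invs_def lookup_Abs intro!: poly_mapping_eqI)
qed

lemma has_coords_inv: "has_coords invs Poly_Mapping.lookup H"
  by (rule has_coordsI) (use inv_extend inv_eqI in auto)

lemma cyc_inv: "r * cyc p \<sigma> \<in> invs"
proof -
  have "r * cyc p \<sigma> * (grp \<sigma> - 1) = 0"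
    using cyc_mult_diff[OF nmul_\<sigma>] by (simp add: mult.assoc)
  then show ?thesis by (simp add: invs_def algebra_simps)
qed

text \<open>
  The ideal generated by \<open>1 + \<sigma> + \<dots> + \<sigma>\<^bsup>p-1\<^esup>\<close> consists of all \<open>\<sigma>\<close>-invariant elements: an
  invariant element is the product of this generator and its own restriction to \<open>H\<close>.
\<close>
lemma range_cyc: "range (\<lambda>r. r * cyc p \<sigma>) = invs"
proof (intro equalityI subsetI)
  fix x assume x: "x \<in> invs"
  define r where "r = Abs_poly_mapping (\<lambda>g. if g \<in> H then Poly_Mapping.lookup x g else 0)"
  have "r * cyc p \<sigma> = x"
  proof (rule inv_eqI[OF cyc_inv x])
    fix h assume h: "h \<in> H"
    then have "Poly_Mapping.lookup (r * cyc p \<sigma>) h = Poly_Mapping.lookup r h"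
      by (intro lookup_mult_cyc_H) (auto simp: r_def lookup_Abs diff_notin_H)
    then show "Poly_Mapping.lookup (r * cyc p \<sigma>) h = Poly_Mapping.lookup x h"
      using h by (simp add: r_def lookup_Abs)
  qed
  then show "x \<in> range (\<lambda>r. r * cyc p \<sigma>)" by blast
qed (use cyc_inv in auto)

lemma lookup_T_G [simp]: "Poly_Mapping.lookup (T_G :: 'g ZG) g = 1"
proof -
  have "Poly_Mapping.lookup (T_G :: 'g ZG) g = (\<Sum>h\<in>UNIV. 1 when h = g)"
    unfolding T_G_def grp_def lookup_sum lookup_single ..
  also have "\<dots> = (\<Sum>h\<in>{g}. 1 when h = g)"
    by (rule sum.mono_neutral_right) (use finite_G in \<open>auto simp: when_def\<close>)
  finally show ?thesis by simp
qed

lemma grp_T_G [simp]: "grp g * T_G = (T_G :: 'g ZG)"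
  by (rule poly_mapping_eqI) simp

lemma lookup_mult_T_G: "Poly_Mapping.lookup (x * T_G) g = (\<Sum>h\<in>UNIV. Poly_Mapping.lookup x h)"
  for x :: "'g ZG"
proof -
  have "Poly_Mapping.lookup (x * T_G) g = (\<Sum>h\<in>UNIV. Poly_Mapping.lookup x (g - h))"
    by (simp add: T_G_def sum_distrib_left lookup_sum)
  also have "\<dots> = (\<Sum>h\<in>UNIV. Poly_Mapping.lookup x h)"
    by (rule sum.reindex_bij_witness[where i = "\<lambda>h. g - h" and j = "\<lambda>h. g - h"]) auto
  finally show ?thesis .
qed

text \<open>The elements with constant coefficients, that is, the invariants of the whole group.\<close>
definition const :: "'g ZG set" where
  "const = {x. \<forall>g. Poly_Mapping.lookup x g = Poly_Mapping.lookup x 0}"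

lemma constD: "x \<in> const \<Longrightarrow> Poly_Mapping.lookup x g = Poly_Mapping.lookup x 0"
  unfolding const_def by blast

lemma range_T_G: "range (\<lambda>r. r * T_G) = const"
proof (intro equalityI subsetI)
  fix x assume "x \<in> const"
  then have "of_int (Poly_Mapping.lookup x 0) * T_G = x"
    unfolding const_def by (intro poly_mapping_eqI) (metis (mono_tags) lookup_T_G lookup_of_int_mult mem_Collect_eq mult.right_neutral)
  then show "x \<in> range (\<lambda>r. r * T_G)" by (metis rangeI)
qed (auto simp: const_def lookup_mult_T_G)

lemma const_grp: "x \<in> const \<Longrightarrow> grp g * x = x"
  by (auto simp: range_T_G[symmetric] mult.left_commute)

lemma constI:
  assumes "x * (grp \<sigma> - 1) = 0" "x * (grp \<rho> - 1) = 0" shows "x \<in> const"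
proof -
  have x: "x \<in> invs" using assms(1) by (simp add: invs_def algebra_simps)
  have rho: "grp \<rho> * x = x" using assms(2) by (simp add: algebra_simps)
  have "Poly_Mapping.lookup x (nmul j \<rho>) = Poly_Mapping.lookup x 0" for j
  proof (induction j)
    case (Suc j)
    have "Poly_Mapping.lookup x (nmul (Suc j) \<rho>) = Poly_Mapping.lookup (grp \<rho> * x) (nmul (Suc j) \<rho>)"
      by (simp only: rho)
    also have "\<dots> = Poly_Mapping.lookup x 0" using Suc by (simp add: nmul_Suc)
    finally show ?case .
  qed simp
  then have "Poly_Mapping.lookup x h = Poly_Mapping.lookup x 0" if "h \<in> H" for h
    using that by (auto simp: H_def)
  then have "Poly_Mapping.lookup x g = Poly_Mapping.lookup x 0" for g
    using inv_proj[OF x] proj_in_H by metis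
  then show ?thesis unfolding const_def by blast
qed

lemma has_coords_const: "has_coords const Poly_Mapping.lookup {0}"
proof (rule has_coordsI)
  fix v :: "'g \<Rightarrow> int"
  have "of_int (v 0) * T_G \<in> const" by (simp add: range_T_G[symmetric])
  then show "\<exists>x\<in>const. \<forall>i\<in>{0}. Poly_Mapping.lookup x i = v i"
    by (intro bexI[of _ "of_int (v 0) * T_G"]) simp_all
next
  fix x y assume "x \<in> const" "y \<in> const"
    and eq: "\<And>i. i \<in> {0} \<Longrightarrow> Poly_Mapping.lookup x i = Poly_Mapping.lookup y i"
  then show "x = y"
    using eq[of 0] constD[of x] constD[of y] by (intro poly_mapping_eqI) (metis insertI1)
qed

lemma const_mult_cyc: "x \<in> const \<Longrightarrow> x * cyc p g = of_nat p * x"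
  by (simp add: cyc_def sum_distrib_left mult.commute[of x] const_grp grp_nmul[symmetric])

lemma has_coords_supp:
  "has_coords {x :: 'g ZG. \<forall>g. g \<notin> K \<longrightarrow> Poly_Mapping.lookup x g = 0} Poly_Mapping.lookup K"
proof (rule has_coordsI)
  fix v :: "'g \<Rightarrow> int"
  show "\<exists>x\<in>{x. \<forall>g. g \<notin> K \<longrightarrow> Poly_Mapping.lookup x g = 0}. \<forall>i\<in>K. Poly_Mapping.lookup x i = v i"
    by (intro bexI[of _ "Abs_poly_mapping (\<lambda>g. if g \<in> K then v g else 0)"]) (auto simp: lookup_Abs)
next
  fix x y :: "'g ZG"
  assume *: "x \<in> {x. \<forall>g. g \<notin> K \<longrightarrow> Poly_Mapping.lookup x g = 0}"
    "y \<in> {x. \<forall>g. g \<notin> K \<longrightarrow> Poly_Mapping.lookup x g = 0}"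
    "\<And>i. i \<in> K \<Longrightarrow> Poly_Mapping.lookup x i = Poly_Mapping.lookup y i"
  show "x = y"
  proof (rule poly_mapping_eqI)
    fix g show "Poly_Mapping.lookup x g = Poly_Mapping.lookup y g"
      using * by (cases "g \<in> K") auto
  qed
qed

lemma has_coords_inv_0:
  "has_coords {x \<in> invs. Poly_Mapping.lookup x 0 = 0} Poly_Mapping.lookup (H - {0})"
proof (rule has_coordsI)
  fix v :: "'g \<Rightarrow> int"
  obtain x where "x \<in> invs" "\<forall>h\<in>H. Poly_Mapping.lookup x h = (v(0 := 0)) h"
    using inv_extend[of "v(0 := 0)"] by auto
  then show "\<exists>x\<in>{x \<in> invs. Poly_Mapping.lookup x 0 = 0}. \<forall>i\<in>H - {0}. Poly_Mapping.lookup x i = v i"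
    using zero_H by (intro bexI[of _ x]) auto
next
  fix x y
  assume *: "x \<in> {x \<in> invs. Poly_Mapping.lookup x 0 = 0}" "y \<in> {x \<in> invs. Poly_Mapping.lookup x 0 = 0}"
    "\<And>i. i \<in> H - {0} \<Longrightarrow> Poly_Mapping.lookup x i = Poly_Mapping.lookup y i"
  show "x = y"
  proof (rule inv_eqI)
    fix h assume "h \<in> H"
    then show "Poly_Mapping.lookup x h = Poly_Mapping.lookup y h"
      using * by (cases "h = 0") auto
  qed (use * in auto)
qed

section \<open>Pairs of group ring elements modulo the multiples of one pair\<close>

text \<open>
  The three lemmas of this part describe representatives of pairs of group ring elements modulo the
  pairs \<open>(\<eta> (\<sigma> - 1), \<eta> (\<rho> - 1))\<close>. By the first one, the first entry can be reduced to an element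
  supported on \<open>H\<close>, since \<open>\<sigma>\<^sup>i h\<close> is congruent to \<open>h\<close> modulo \<open>\<sigma> - 1\<close>.
\<close>
lemma reduce_first:
  "\<exists>\<eta>. \<forall>g. g \<notin> H \<longrightarrow> Poly_Mapping.lookup (x - \<eta> * (grp \<sigma> - 1)) g = 0"
proof (induction x rule: group_ring_induct)
  case zero
  show ?case by (rule exI[of _ 0]) simp
next
  case (grp g)
  obtain i where i: "g = nmul i \<sigma> + proj g" using proj_decomp by blast
  define \<eta> where "\<eta> = grp (proj g) * (\<Sum>j<i. grp \<sigma> ^ j)"
  have "grp \<sigma> ^ i - 1 = (grp \<sigma> - 1) * (\<Sum>j<i. grp \<sigma> ^ j)" by (rule power_diff_1_eq)
  then have "\<eta> * (grp \<sigma> - 1) = grp (proj g) * (grp \<sigma> ^ i - 1)"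
    by (simp add: \<eta>_def mult_ac)
  also have "\<dots> = grp g - grp (proj g)"
    by (subst (2) i) (simp add: grp_add grp_nmul algebra_simps)
  finally have "grp g - \<eta> * (grp \<sigma> - 1) = grp (proj g)" by simp
  then show ?case
    using proj_in_H[of g] by (intro exI[of _ \<eta>]) (auto simp: grp_def lookup_single when_def)
next
  case (diff a b)
  then obtain \<eta> \<eta>' where
    "\<forall>g. g \<notin> H \<longrightarrow> Poly_Mapping.lookup (a - \<eta> * (grp \<sigma> - 1)) g = 0"
    "\<forall>g. g \<notin> H \<longrightarrow> Poly_Mapping.lookup (b - \<eta>' * (grp \<sigma> - 1)) g = 0" by blast
  moreover have "a - b - (\<eta> - \<eta>') * (grp \<sigma> - 1) = (a - \<eta> * (grp \<sigma> - 1)) - (b - \<eta>' * (grp \<sigma> - 1))"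
    by (simp add: algebra_simps)
  ultimately show ?case
    by (intro exI[of _ "\<eta> - \<eta>'"]) (simp only: lookup_minus, simp)
qed

text \<open>
  The remaining freedom, a \<open>\<sigma>\<close>-invariant \<open>\<eta>\<close>, can be used to make the second entry vanish on \<open>H\<close>
  except at the neutral element. On \<open>H\<close> the coefficients of \<open>\<eta> (\<rho> - 1)\<close> are the negatives of the
  backward differences of \<open>\<eta>\<close>, so the coefficients of \<open>\<eta>\<close> are chosen as negatives of partial sums.
\<close>
lemma reduce_second:
  "\<exists>\<eta>\<in>invs. \<forall>h\<in>H - {0}. Poly_Mapping.lookup (x - \<eta> * (grp \<rho> - 1)) h = 0"
proof -
  define idx where "idx = inv_into {..<p} (\<lambda>j. nmul j \<rho>)"
  have idx: "idx (nmul j \<rho>) = j" if "j < p" for j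
    unfolding idx_def
    by (rule inv_into_f_f) (use that nmul_eq_iff[of 0 _ 0] p_pos in \<open>auto simp: inj_on_def\<close>)
  obtain \<eta> where \<eta>: "\<eta> \<in> invs" "\<forall>h\<in>H. Poly_Mapping.lookup \<eta> h
      = - (\<Sum>i=1..idx h. Poly_Mapping.lookup x (nmul i \<rho>))"
    using inv_extend[of "\<lambda>h. - (\<Sum>i=1..idx h. Poly_Mapping.lookup x (nmul i \<rho>))"] by blast
  have \<eta>j: "Poly_Mapping.lookup \<eta> (nmul j \<rho>) = - (\<Sum>i=1..j. Poly_Mapping.lookup x (nmul i \<rho>))"
    if "j < p" for j
    using \<eta>(2) nmul_\<rho>_H[of j] idx[OF that] by simp
  have "Poly_Mapping.lookup (x - \<eta> * (grp \<rho> - 1)) h = 0" if h: "h \<in> H - {0}" for h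
  proof -
    obtain j where j: "j < p" "h = nmul j \<rho>" using h by (auto simp: H_def)
    then obtain i where i: "j = Suc i" using h by (cases j) auto
    have "Poly_Mapping.lookup (x - \<eta> * (grp \<rho> - 1)) h
        = Poly_Mapping.lookup x h - (Poly_Mapping.lookup \<eta> (nmul i \<rho>) - Poly_Mapping.lookup \<eta> (nmul j \<rho>))"
      by (simp add: lookup_minus right_diff_distrib j i nmul_Suc)
    also have "\<dots> = 0" using j by (simp add: \<eta>j i)
    finally show ?thesis .
  qed
  then show ?thesis using \<eta>(1) by blast
qed

text \<open>
  Conversely, if the pair \<open>(\<eta> (\<sigma> - 1), \<eta> (\<rho> - 1))\<close> is reduced, then it is zero,
  so that \<open>\<eta>\<close> is constant. A multiple of \<open>\<sigma> - 1\<close> is annihilated by \<open>1 + \<sigma> + \<dots> + \<sigma>\<^bsup>p-1\<^esup>\<close>, so it vanishes if it is supported on the transversal \<open>H\<close>;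
  the same argument with \<open>\<sigma>\<close> and \<open>\<rho>\<close> exchanged shows that the coefficient of the second entry at the
  neutral element vanishes as well, and this entry is \<open>\<sigma>\<close>-invariant once \<open>\<eta>\<close> is.
\<close>
lemma reduced_imp_const:
  assumes swap: "generating_pair p \<rho> \<sigma>"
    and 1: "\<And>g. g \<notin> H \<Longrightarrow> Poly_Mapping.lookup (\<eta> * (grp \<sigma> - 1)) g = 0"
    and 2: "\<And>h. h \<in> H - {0} \<Longrightarrow> Poly_Mapping.lookup (\<eta> * (grp \<rho> - 1)) h = 0"
  shows "\<eta> \<in> const"
proof (rule constI)
  let ?x = "\<eta> * (grp \<sigma> - 1)" and ?y = "\<eta> * (grp \<rho> - 1)"
  have "Poly_Mapping.lookup ?x h = 0" if "h \<in> H" for h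
  proof -
    have "Poly_Mapping.lookup ?x h = Poly_Mapping.lookup (?x * cyc p \<sigma>) h"
      using that by (intro lookup_mult_cyc_H[symmetric] 1 diff_notin_H)
    also have "?x * cyc p \<sigma> = 0"
      by (simp only: mult.assoc mult.commute[of "grp \<sigma> - 1"] cyc_mult_diff[OF nmul_\<sigma>] mult_zero_right)
    finally show ?thesis by simp
  qed
  then show x: "?x = 0" using 1 by (intro poly_mapping_eqI) (metis lookup_zero)
  have "\<eta> \<in> invs" using x by (simp add: invs_def algebra_simps)
  then have y: "?y \<in> invs" by (simp add: invs_def mult.assoc[symmetric])
  interpret S: generating_pair p \<rho> \<sigma> by (rule swap)
  have "Poly_Mapping.lookup ?y 0 = Poly_Mapping.lookup (?y * cyc p \<rho>) 0"
  proof (intro S.lookup_mult_cyc_H[symmetric] S.zero_H 2)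
    fix j assume j: "0 < j" "j < p"
    then have "0 - nmul j \<rho> = nmul (p - j) \<rho>" using S.diff_nmul[of j 0] by simp
    moreover have "nmul (p - j) \<rho> \<noteq> 0" using nmul_eq_iff[of 0 "p - j" 0 0] j by simp
    ultimately show "0 - nmul j \<rho> \<in> H - {0}" using nmul_\<rho>_H by simp
  qed
  also have "?y * cyc p \<rho> = 0"
    by (simp only: mult.assoc mult.commute[of "grp \<rho> - 1"] cyc_mult_diff[OF nmul_\<rho>] mult_zero_right)
  finally have "Poly_Mapping.lookup ?y h = 0" if "h \<in> H" for h
    using 2[of h] that by (cases "h = 0") simp_all
  moreover have "(0 :: 'g ZG) \<in> invs" by (simp add: invs_def)
  ultimately show "?y = 0" using y by (intro inv_eqI) auto
qed

end

section \<open>Change of generators\<close>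

lemma generating_pair_swap:
  assumes "generating_pair p \<sigma> \<rho>" shows "generating_pair p \<rho> \<sigma>"
  using assms unfolding generating_pair_def by (metis add.commute)

lemma generating_pair_shear:
  assumes "generating_pair p \<sigma> \<rho>" shows "generating_pair p (\<sigma> + nmul n \<rho>) \<rho>"
proof -
  interpret generating_pair p \<sigma> \<rho> by fact
  show ?thesis
  proof
    have "nmul p (nmul n \<rho>) = 0"
      by (metis nmul_\<rho> mult.commute nmul_mult nmul_zero)
    then show "nmul p (\<sigma> + nmul n \<rho>) = 0" by (simp add: nmul_add_right nmul_\<sigma>)
  next
    fix g
    obtain i j where g: "g = nmul i \<sigma> + nmul j \<rho>" using gen by blast
    \<comment> \<open>subtracting \<open>i * n\<close> multiples of \<open>\<rho>\<close> amounts to adding \<open>(p - 1) * (i * n)\<close> of them\<close>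
    have "nmul (i * n) \<rho> + nmul ((p - 1) * (i * n)) \<rho> = nmul (p * (i * n)) \<rho>"
      using p_pos by (simp add: nmul_add[symmetric] algebra_simps)
    also have "\<dots> = 0" by (metis nmul_\<rho> mult.commute nmul_mult nmul_zero)
    finally have "g = nmul i (\<sigma> + nmul n \<rho>) + nmul (j + (p - 1) * (i * n)) \<rho>"
      by (simp add: g nmul_add_right nmul_add nmul_mult[symmetric] algebra_simps)
    then show "\<exists>i j. g = nmul i (\<sigma> + nmul n \<rho>) + nmul j \<rho>" by blast
  qed (use p_pos nmul_\<rho> card_G in auto)
qed

lemma generating_pair_of_generators:
  fixes \<tau>\<^sub>1 \<tau>\<^sub>2 :: "'g::ab_group_add"
  assumes p0: "p > 0"
    and iso: "(type_group :: 'g monoid) \<cong> integer_mod_group p \<times>\<times> integer_mod_group p"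
    and gen: "generate type_group {\<tau>\<^sub>1, \<tau>\<^sub>2} = (UNIV :: 'g set)"
  shows "generating_pair p \<tau>\<^sub>1 \<tau>\<^sub>2"
proof -
  obtain f where f: "f \<in> Group.iso (type_group :: 'g monoid) (integer_mod_group p \<times>\<times> integer_mod_group p)"
    using iso unfolding is_iso_def by blast
  then have bij: "bij_betw f (UNIV :: 'g set) ({0..<int p} \<times> {0..<int p})"
    using p0 by (simp add: Group.iso_def type_group_def DirProd_def carrier_integer_mod_group)
  have card: "card (UNIV :: 'g set) = p\<^sup>2"
    using bij_betw_same_card[OF bij] by (simp add: card_cartesian_product power2_eq_square)
  have hom: "f (g + h) = ((fst (f g) + fst (f h)) mod int p, (snd (f g) + snd (f h)) mod int p)" for g h
  proof -
    have "f (g + h) = f g \<otimes>\<^bsub>integer_mod_group p \<times>\<times> integer_mod_group p\<^esub> f h"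
      using f by (simp add: Group.iso_def hom_def type_group_def)
    then show ?thesis by (cases "f g"; cases "f h") simp
  qed
  have rng: "0 \<le> fst (f g)" "fst (f g) < int p" "0 \<le> snd (f g)" "snd (f g) < int p" for g
    using bij_betw_apply[OF bij UNIV_I, of g] by (auto simp: mem_Times_iff)
  \<comment> \<open>the term \<open>f 0\<close> need not be computed: for \<open>n = p\<close> the right-hand side is \<open>f 0\<close>\<close>
  have f_nmul: "f (nmul n g) = ((fst (f 0) + int n * fst (f g)) mod int p,
      (snd (f 0) + int n * snd (f g)) mod int p)" for n g
  proof (induction n)
    case 0
    show ?case using rng[of 0] by (simp add: prod_eq_iff)
  next
    case (Suc n)
    show ?case by (simp add: nmul_Suc hom Suc mod_simps algebra_simps)
  qed
  have nmul_p: "nmul p g = 0" for g :: 'g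
  proof -
    have "f (nmul p g) = f 0" using rng[of 0] by (simp add: f_nmul prod_eq_iff)
    then show ?thesis using bij by (auto simp: bij_betw_def inj_on_def)
  qed
  have inv_tg: "inv\<^bsub>type_group\<^esub> g = - g" for g :: 'g
    by (auto simp: m_inv_def type_group_def add_eq_0_iff intro!: the_equality)
  have minus: "- g = nmul (p - 1) g" for g :: 'g
    using nmul_p[of g] p0 nmul_Suc[of "p - 1" g] by (simp add: minus_unique add.commute)
  have "\<exists>i j. g = nmul i \<tau>\<^sub>1 + nmul j \<tau>\<^sub>2" for g
  proof -
    have "g \<in> generate type_group {\<tau>\<^sub>1, \<tau>\<^sub>2}" using gen by simp
    then show ?thesis
    proof (induction rule: generate.induct)
      case one
      show ?case by (intro exI[of _ 0]) (simp add: type_group_def)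
    next
      case (incl h)
      then consider "h = \<tau>\<^sub>1" | "h = \<tau>\<^sub>2" by blast
      then show ?case
      proof cases
        case 1 then show ?thesis by (intro exI[of _ 1] exI[of _ 0]) simp
      next
        case 2 then show ?thesis by (intro exI[of _ 0] exI[of _ 1]) simp
      qed
    next
      case (inv h)
      then consider "h = \<tau>\<^sub>1" | "h = \<tau>\<^sub>2" by blast
      then show ?case
      proof cases
        case 1 then show ?thesis by (intro exI[of _ "p - 1"] exI[of _ 0]) (simp add: inv_tg minus)
      next
        case 2 then show ?thesis by (intro exI[of _ 0] exI[of _ "p - 1"]) (simp add: inv_tg minus)
      qed
    next
      case (eng h1 h2)
      then obtain i j i' j' where "h1 = nmul i \<tau>\<^sub>1 + nmul j \<tau>\<^sub>2" "h2 = nmul i' \<tau>\<^sub>1 + nmul j' \<tau>\<^sub>2"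
        by blast
      then have "h1 + h2 = nmul (i + i') \<tau>\<^sub>1 + nmul (j + j') \<tau>\<^sub>2"
        by (simp add: nmul_add algebra_simps)
      then show ?case by (auto simp: type_group_def)
    qed
  qed
  then show ?thesis using p0 card nmul_p by unfold_locales auto
qed

section \<open>The modules and maps\<close>

text \<open>
  The setting of the theorem. The subscript \<open>4\<close> stands for the index \<open>p + 1\<close>, and \<open>\<tau>\<^bsub>p+1\<^esub>\<close> is
  \<open>\<tau>\<^sub>1 \<tau>\<^sub>2\<^bsup>p-1\<^esup>\<close>. Together with \<open>\<tau>\<^sub>2\<close>, each of \<open>\<tau>\<^sub>1\<close>, \<open>\<tau>\<^sub>3\<close>, \<open>\<tau>\<^sub>4\<close> is a generating pair, and the
  set \<open>H\<close>, the subgroup generated by \<open>\<tau>\<^sub>2\<close>, is the same for the three pairs.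
\<close>
locale resolution_setup = generating_pair p \<tau>\<^sub>1 \<tau>\<^sub>2 for p and \<tau>\<^sub>1 \<tau>\<^sub>2 :: "'g::ab_group_add" +
  fixes \<kappa>\<^sub>1 \<kappa>\<^sub>2 :: "'g ZG"
  assumes odd_p: "odd p" and p3: "p \<ge> 3"
    and kappa: "kappa_rel p \<tau>\<^sub>1 \<tau>\<^sub>2 \<kappa>\<^sub>1 \<kappa>\<^sub>2"
begin

abbreviation "\<tau>\<^sub>3 \<equiv> \<tau>\<^sub>1 + \<tau>\<^sub>2"
abbreviation "\<tau>\<^sub>4 \<equiv> \<tau>\<^sub>1 + nmul (p - Suc 0) \<tau>\<^sub>2"
abbreviation "T\<^sub>3 \<equiv> cyc p \<tau>\<^sub>3"
abbreviation "T\<^sub>4 \<equiv> cyc p \<tau>\<^sub>4"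
abbreviation "t\<^sub>1 \<equiv> grp \<tau>\<^sub>1 - 1"
abbreviation "t\<^sub>2 \<equiv> grp \<tau>\<^sub>2 - 1"
abbreviation "m \<equiv> (of_nat ((p - 1) div 2) :: 'g ZG)"

sublocale swap: generating_pair p \<tau>\<^sub>2 \<tau>\<^sub>1
  by (rule generating_pair_swap, rule generating_pair_axioms)
sublocale R3: generating_pair p \<tau>\<^sub>3 \<tau>\<^sub>2
  using generating_pair_shear[OF generating_pair_axioms, of 1] by simp
sublocale R4: generating_pair p \<tau>\<^sub>4 \<tau>\<^sub>2
  by (rule generating_pair_shear, rule generating_pair_axioms)

lemma tk_simps [simp]: "tk \<tau>\<^sub>1 \<tau>\<^sub>2 1 = t\<^sub>1" "tk \<tau>\<^sub>1 \<tau>\<^sub>2 (Suc 0) = t\<^sub>1" "tk \<tau>\<^sub>1 \<tau>\<^sub>2 2 = t\<^sub>2"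
  by (simp_all add: tk_def tau_def)

lemma Tk_simps [simp]: "Tk p \<tau>\<^sub>1 \<tau>\<^sub>2 3 = T\<^sub>3" "Tk p \<tau>\<^sub>1 \<tau>\<^sub>2 (p + 1) = T\<^sub>4" "Tk p \<tau>\<^sub>1 \<tau>\<^sub>2 (Suc p) = T\<^sub>4"
  using p3 by (simp_all add: Tk_def cyc_def tau_def grp_add grp_nmul)

lemma kappa_eq: "t\<^sub>1 * \<kappa>\<^sub>1 + t\<^sub>2 * \<kappa>\<^sub>2 + m * T\<^sub>3 + m * T\<^sub>4 = T_G - of_nat p"
  using kappa by (simp add: kappa_rel_def)

lemma two_m: "2 * m = of_nat p - 1"
proof -
  have "2 * ((p - 1) div 2) + 1 = p" using odd_p p3 by presburger
  then have "(of_nat (2 * ((p - 1) div 2) + 1) :: 'g ZG) = of_nat p" by (simp only:)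
  then show ?thesis by (simp add: algebra_simps)
qed

lemma const_le: "const \<subseteq> R3.invs" "const \<subseteq> R4.invs"
  using const_grp by (auto simp: R3.invs_def R4.invs_def)

lemma T_G_T: "T_G * T\<^sub>3 = of_nat p * T_G" "T_G * T\<^sub>4 = of_nat p * T_G"
  "T\<^sub>3 * T_G = of_nat p * T_G" "T\<^sub>4 * T_G = of_nat p * T_G"
proof -
  have "(T_G :: 'g ZG) \<in> const" by (auto simp: range_T_G[symmetric] intro: range_eqI[of _ _ 1])
  from const_mult_cyc[OF this] show "T_G * T\<^sub>3 = of_nat p * T_G" "T_G * T\<^sub>4 = of_nat p * T_G"
    "T\<^sub>3 * T_G = of_nat p * T_G" "T\<^sub>4 * T_G = of_nat p * T_G" by (simp_all add: mult.commute[of _ T_G])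
qed

lemma const_mult_T_G: "x \<in> const \<Longrightarrow> x * T_G = of_nat p * (of_nat p * x)"
proof (rule poly_mapping_eqI)
  fix g assume x: "x \<in> const"
  have "(\<Sum>h\<in>UNIV. Poly_Mapping.lookup x h) = (\<Sum>h\<in>(UNIV :: 'g set). Poly_Mapping.lookup x 0)"
    by (rule sum.cong[OF refl]) (rule constD[OF x])
  also have "\<dots> = int p * (int p * Poly_Mapping.lookup x g)"
    using constD[OF x, of g] by (simp add: card_G power2_eq_square)
  finally show "Poly_Mapping.lookup (x * T_G) g = Poly_Mapping.lookup (of_nat p * (of_nat p * x)) g"
    by (simp only: lookup_mult_T_G lookup_of_nat_mult)
qed

lemma const_t: "x \<in> const \<Longrightarrow> x * t\<^sub>1 = 0" "x \<in> const \<Longrightarrow> x * t\<^sub>2 = 0"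
  using const_grp[of x] by (simp_all add: right_diff_distrib mult.commute[of x])

lemma carrier_M1: "carrier (M1 :: ('g ZG, 'g ZG) module) = const"
  by (simp add: M1_def range_T_G)

lemma carrier_M2: "carrier (M2 :: ('g ZG, 'g ZG \<times> 'g ZG) module) = UNIV \<times> const"
  by (simp add: M2_def range_T_G)

lemma carrier_M3: "carrier (M3 p \<tau>\<^sub>1 \<tau>\<^sub>2) = UNIV \<times> UNIV \<times> R3.invs \<times> R4.invs"
  by (simp add: M3_def R3.range_cyc R4.range_cyc)

lemma M1_ops [simp]: "x \<oplus>\<^bsub>M1\<^esub> y = x + y" "r \<odot>\<^bsub>M1\<^esub> x = r * x" "\<zero>\<^bsub>M1\<^esub> = 0"
  for x y r :: "'g ZG"
  by (simp_all add: M1_def)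

lemma M2_ops [simp]: "x \<oplus>\<^bsub>M2\<^esub> y = x + y" "r \<odot>\<^bsub>M2\<^esub> (a, b) = (r * a, r * b)" "\<zero>\<^bsub>M2\<^esub> = 0"
  for x y :: "'g ZG \<times> 'g ZG" and r :: "'g ZG"
  by (cases x; cases y; simp add: M2_def zero_prod_def)+

lemma M3_ops [simp]: "x \<oplus>\<^bsub>M3 p \<tau>\<^sub>1 \<tau>\<^sub>2\<^esub> y = x + y"
  "r \<odot>\<^bsub>M3 p \<tau>\<^sub>1 \<tau>\<^sub>2\<^esub> (a, b, c, d) = (r * a, r * b, r * c, r * d)" "\<zero>\<^bsub>M3 p \<tau>\<^sub>1 \<tau>\<^sub>2\<^esub> = 0"
  for x y :: "'g ZG \<times> 'g ZG \<times> 'g ZG \<times> 'g ZG" and r :: "'g ZG"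
  by (cases x; cases y; simp add: M3_def zero_prod_def)+

lemma module_const: "module Z_G (ideal_module (const :: 'g ZG set))"
  by (rule module_ideal_module) (auto simp: range_T_G[symmetric] image_iff distrib_right[symmetric] mult.assoc[symmetric]
      intro: exI[of _ 0])

lemma module_M1: "module Z_G (M1 :: ('g ZG, 'g ZG) module)"
  unfolding M1_def range_T_G by (rule module_const)

lemma module_UNIV: "module Z_G (ideal_module (UNIV :: 'g ZG set))"
  by (rule module_ideal_module) auto

lemma module_M2: "module Z_G (M2 :: ('g ZG, 'g ZG \<times> 'g ZG) module)"
  unfolding M2_def range_T_G by (intro module_module_sum module_UNIV module_const)

lemma invs_closed:
  "0 \<in> R3.invs" "\<And>x y. x \<in> R3.invs \<Longrightarrow> y \<in> R3.invs \<Longrightarrow> x + y \<in> R3.invs" "\<And>r x. x \<in> R3.invs \<Longrightarrow> r * x \<in> R3.invs"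
  "0 \<in> R4.invs" "\<And>x y. x \<in> R4.invs \<Longrightarrow> y \<in> R4.invs \<Longrightarrow> x + y \<in> R4.invs" "\<And>r x. x \<in> R4.invs \<Longrightarrow> r * x \<in> R4.invs"
  by (auto simp: R3.invs_def R4.invs_def distrib_left mult.left_commute)

lemma module_M3: "module Z_G (M3 p \<tau>\<^sub>1 \<tau>\<^sub>2)"
  unfolding M3_def Tk_simps R3.range_cyc R4.range_cyc
  by (intro module_module_sum module_UNIV; rule module_ideal_module; fact invs_closed)

lemma minus_M3: "x \<ominus>\<^bsub>M3 p \<tau>\<^sub>1 \<tau>\<^sub>2\<^esub> y = x - y"
  if "x \<in> carrier (M3 p \<tau>\<^sub>1 \<tau>\<^sub>2)" "y \<in> carrier (M3 p \<tau>\<^sub>1 \<tau>\<^sub>2)"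
proof -
  interpret M3: module Z_G "M3 p \<tau>\<^sub>1 \<tau>\<^sub>2" by (rule module_M3)
  have "y + (\<ominus>\<^bsub>M3 p \<tau>\<^sub>1 \<tau>\<^sub>2\<^esub> y) = 0" using M3.M.r_neg[OF that(2)] by simp
  then have "\<ominus>\<^bsub>M3 p \<tau>\<^sub>1 \<tau>\<^sub>2\<^esub> y = - y" by (simp add: add_eq_0_iff)
  then show ?thesis by (simp add: a_minus_def)
qed

section \<open>Exactness and the contracting maps\<close>

text \<open>The modules and maps of the complex with their parameters fixed.\<close>
abbreviation "\<M>\<^sub>3 \<equiv> M3 p \<tau>\<^sub>1 \<tau>\<^sub>2"
abbreviation "\<M>\<^sub>4 \<equiv> M4 p \<tau>\<^sub>1 \<tau>\<^sub>2"
abbreviation "\<delta>\<^sub>2 \<equiv> d2 p \<tau>\<^sub>1 \<tau>\<^sub>2"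
abbreviation "\<delta>\<^sub>3 \<equiv> d3 p \<tau>\<^sub>1 \<tau>\<^sub>2"
abbreviation "\<hh>\<^sub>2 \<equiv> h2 p \<kappa>\<^sub>1 \<kappa>\<^sub>2"
abbreviation "\<hh>\<^sub>3 \<equiv> h3 p \<tau>\<^sub>1 \<tau>\<^sub>2 \<kappa>\<^sub>1 \<kappa>\<^sub>2"
abbreviation "\<hh>\<^sub>3_rep \<equiv> h3_rep p \<tau>\<^sub>1 \<tau>\<^sub>2 \<kappa>\<^sub>1 \<kappa>\<^sub>2"
abbreviation "P \<equiv> (of_nat p :: 'g ZG)"

lemma d2_eq: "\<delta>\<^sub>2 (\<eta>, x) = (- (\<eta> * t\<^sub>1), - (\<eta> * t\<^sub>2), \<eta> * T\<^sub>3 + x, \<eta> * T\<^sub>4 + x)"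
  by (simp add: d2_def del: One_nat_def)

lemma h2_eq: "\<hh>\<^sub>2 (a, b, c, d) = (a * \<kappa>\<^sub>1 + b * \<kappa>\<^sub>2 - m * c - m * d, c * T_G)"
  by (simp add: h2_def)

lemma of_nat_p_minus_1: "(of_nat (p - 1) :: 'g ZG) = P - 1"
  using p3 by (simp add: of_nat_diff)

lemma mult_T_G_const: "x * T_G \<in> const" for x :: "'g ZG"
  using range_T_G by blast

lemma const_closed:
  "x \<in> const \<Longrightarrow> y \<in> const \<Longrightarrow> x + y \<in> const" "x \<in> const \<Longrightarrow> r * x \<in> const" "x \<in> const \<Longrightarrow> - x \<in> const"
  for x y r :: "'g ZG"
proof -
  interpret K: module Z_G "ideal_module (const :: 'g ZG set)" by (rule module_const)
  show "x \<in> const \<Longrightarrow> y \<in> const \<Longrightarrow> x + y \<in> const" "x \<in> const \<Longrightarrow> r * x \<in> const"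
    "x \<in> const \<Longrightarrow> - x \<in> const"
    using K.M.a_closed[of x y] K.smult_closed[of r x] K.smult_closed[of "- 1" x] by simp_all
qed

lemma d2_carrier: "y \<in> UNIV \<times> const \<Longrightarrow> \<delta>\<^sub>2 y \<in> carrier \<M>\<^sub>3"
  by (auto simp: d2_eq carrier_M3 intro!: invs_closed(2,5) R3.cyc_inv R4.cyc_inv
      intro: subsetD[OF const_le(1)] subsetD[OF const_le(2)])

lemma h2_carrier: "\<hh>\<^sub>2 y \<in> UNIV \<times> const"
  by (cases y) (auto simp: h2_eq mult_T_G_const)

lemma d2_add: "\<delta>\<^sub>2 (x + y) = \<delta>\<^sub>2 x + \<delta>\<^sub>2 y"
  by (cases x; cases y) (simp add: d2_eq algebra_simps)

lemma d2_smult: "\<delta>\<^sub>2 (r * a, r * x) = r \<odot>\<^bsub>\<M>\<^sub>3\<^esub> \<delta>\<^sub>2 (a, x)"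
  by (simp add: d2_eq algebra_simps)

lemma d2_diff: "\<delta>\<^sub>2 (x - y) = \<delta>\<^sub>2 x - \<delta>\<^sub>2 y"
  by (cases x; cases y) (simp add: d2_eq algebra_simps)

lemma h2_add: "\<hh>\<^sub>2 (x + y) = \<hh>\<^sub>2 x + \<hh>\<^sub>2 y"
  by (cases x; cases y) (simp add: h2_eq algebra_simps)

lemma hom_d1: "module_hom_of Z_G (M1 :: ('g ZG, 'g ZG) module) M2 (d1 p)"
  using module_M1 module_M2 const_closed
  by (auto simp: module_hom_of_def d1_def carrier_M1 carrier_M2 distrib_left mult.left_commute)

lemma hom_d2: "module_hom_of Z_G M2 \<M>\<^sub>3 \<delta>\<^sub>2"
  using module_M2 module_M3 d2_carrier
  by (auto simp: module_hom_of_def carrier_M2 d2_add d2_smult simp del: M3_ops(2))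

lemma hom_h1: "module_hom_of Z_G M2 (M1 :: ('g ZG, 'g ZG) module) (h1 p)"
  using module_M1 module_M2
    const_closed(1)[OF mult_T_G_const const_closed(2)]
  by (auto simp: module_hom_of_def h1_def carrier_M1 carrier_M2 distrib_left distrib_right mult.assoc
      mult.left_commute)

lemma hom_h2: "module_hom_of Z_G \<M>\<^sub>3 M2 \<hh>\<^sub>2"
  using module_M3 module_M2 h2_carrier
  by (auto simp: module_hom_of_def carrier_M2 h2_add) (simp_all add: h2_eq algebra_simps)

abbreviation "\<N> \<equiv> \<delta>\<^sub>2 ` carrier M2"

sublocale Q: quotient_module Z_G \<M>\<^sub>3 \<N>
proof (intro quotient_module.intro quotient_module_axioms.intro module_M3)
  show "\<N> \<subseteq> carrier \<M>\<^sub>3" using d2_carrier by (auto simp: carrier_M2)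
  have "\<delta>\<^sub>2 (0, 0) = 0" by (simp add: d2_eq zero_prod_def)
  moreover have "(0 :: 'g ZG) \<in> const" by (auto simp: const_def)
  ultimately show "\<zero>\<^bsub>\<M>\<^sub>3\<^esub> \<in> \<N>" by (force simp: carrier_M2)
next
  fix x y assume "x \<in> \<N>" "y \<in> \<N>"
  then obtain u v where "u \<in> UNIV \<times> const" "v \<in> UNIV \<times> const" "x = \<delta>\<^sub>2 u" "y = \<delta>\<^sub>2 v"
    by (auto simp: carrier_M2)
  then show "x \<oplus>\<^bsub>\<M>\<^sub>3\<^esub> y \<in> \<N>"
    using const_closed(1) by (intro image_eqI[of _ _ "u + v"]) (auto simp: carrier_M2 d2_add)
next
  fix r x assume "x \<in> \<N>"
  then obtain a y where "y \<in> const" "x = \<delta>\<^sub>2 (a, y)"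
    by (auto simp: carrier_M2)
  then show "r \<odot>\<^bsub>\<M>\<^sub>3\<^esub> x \<in> \<N>"
    using const_closed(2) by (intro image_eqI[of _ _ "(r * a, r * y)"]) (auto simp: carrier_M2 d2_smult)
qed

lemma M4_eq: "\<M>\<^sub>4 = \<M>\<^sub>3 Quot\<^sub>m \<N>"
  by (simp add: M4_def)

lemma d3_eq: "\<delta>\<^sub>3 = (\<lambda>x. \<N> +>\<^bsub>\<M>\<^sub>3\<^esub> x)"
  by (rule ext) (simp add: d3_def)

lemma hom_d3: "module_hom_of Z_G \<M>\<^sub>3 \<M>\<^sub>4 \<delta>\<^sub>3"
  unfolding M4_eq d3_eq by (rule Q.module_hom_of_coset)

lemma d2_d1: "x \<in> const \<Longrightarrow> \<delta>\<^sub>2 (d1 p x) = 0"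
  by (simp add: d1_def d2_eq const_t const_mult_cyc zero_prod_def)

lemma exact:
  "inj_on (d1 p) (carrier (M1 :: ('g ZG, 'g ZG) module))"
  "d1 p ` carrier M1 = a_kernel M2 \<M>\<^sub>3 \<delta>\<^sub>2"
  "\<N> = a_kernel \<M>\<^sub>3 \<M>\<^sub>4 \<delta>\<^sub>3"
  "\<delta>\<^sub>3 ` carrier \<M>\<^sub>3 = carrier \<M>\<^sub>4"
proof -
  show "inj_on (d1 p) (carrier (M1 :: ('g ZG, 'g ZG) module))"
    by (auto simp: inj_on_def d1_def)
  have "y \<in> d1 p ` const" if y: "y \<in> UNIV \<times> const" "\<delta>\<^sub>2 y = 0" for y
  proof -
    obtain \<eta> x where y': "y = (\<eta>, x)" by (cases y)
    have "\<eta> * t\<^sub>1 = 0" "\<eta> * t\<^sub>2 = 0" "\<eta> * T\<^sub>3 + x = 0"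
      using y(2) by (simp_all add: y' d2_eq zero_prod_def)
    then have \<eta>: "\<eta> \<in> const" and "\<eta> * T\<^sub>3 + x = 0" by (auto intro: constI)
    then have "y = d1 p \<eta>" by (simp add: y' d1_def const_mult_cyc add_eq_0_iff)
    then show ?thesis using \<eta> by blast
  qed
  then show "d1 p ` carrier M1 = a_kernel M2 \<M>\<^sub>3 \<delta>\<^sub>2"
    using const_closed d2_d1 by (auto simp: a_kernel_def' carrier_M1 carrier_M2) (auto simp: d1_def)
  show "\<N> = a_kernel \<M>\<^sub>3 \<M>\<^sub>4 \<delta>\<^sub>3"
    unfolding M4_eq d3_eq by (rule Q.a_kernel_coset[symmetric])
  show "\<delta>\<^sub>3 ` carrier \<M>\<^sub>3 = carrier \<M>\<^sub>4"
    unfolding M4_eq d3_eq by (rule Q.carrier_quot[symmetric])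
qed

lemma h1_d1: "x \<in> const \<Longrightarrow> h1 p (d1 p x) = P * x"
  using const_mult_T_G[of x]
  by (simp add: h1_def d1_def of_nat_p_minus_1 algebra_simps del: One_nat_def)

text \<open>
  The identity \<open>d\<^sub>1 h\<^sub>1 + h\<^sub>2 d\<^sub>2 = p\<close>; its first component is the relation between \<open>\<kappa>\<^sub>1\<close> and
  \<open>\<kappa>\<^sub>2\<close>, multiplied by \<open>- \<eta>\<close>.
\<close>
lemma d1_h1_h2_d2:
  assumes "x \<in> const"
  shows "d1 p (h1 p (\<eta>, x)) + \<hh>\<^sub>2 (\<delta>\<^sub>2 (\<eta>, x)) = (P * \<eta>, P * x)"
proof -
  have "\<eta> * T_G + (P - 1) * x
      + (- (\<eta> * t\<^sub>1) * \<kappa>\<^sub>1 + - (\<eta> * t\<^sub>2) * \<kappa>\<^sub>2 - m * (\<eta> * T\<^sub>3 + x) - m * (\<eta> * T\<^sub>4 + x))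
    = \<eta> * T_G + (P - 1) * x - \<eta> * (t\<^sub>1 * \<kappa>\<^sub>1 + t\<^sub>2 * \<kappa>\<^sub>2 + m * T\<^sub>3 + m * T\<^sub>4) - 2 * m * x"
    by (simp add: algebra_simps)
  also have "\<dots> = P * \<eta>"
    by (simp only: kappa_eq two_m) (simp add: algebra_simps)
  finally have 1: "\<eta> * T_G + (P - 1) * x
      + (- (\<eta> * t\<^sub>1) * \<kappa>\<^sub>1 + - (\<eta> * t\<^sub>2) * \<kappa>\<^sub>2 - m * (\<eta> * T\<^sub>3 + x) - m * (\<eta> * T\<^sub>4 + x)) = P * \<eta>" .
  have "(\<eta> * T\<^sub>3 + x) * T_G = \<eta> * (T\<^sub>3 * T_G) + x * T_G" by (simp add: algebra_simps)
  then have 2: "- (P * (\<eta> * T_G + (P - 1) * x)) + (\<eta> * T\<^sub>3 + x) * T_G = P * x"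
    using const_mult_T_G[OF assms] by (simp add: T_G_T algebra_simps)
  show ?thesis
    by (simp only: d1_def h1_def d2_eq h2_eq of_nat_p_minus_1 prod.case add_Pair 1 2)
qed

lemma pow_M3: "x \<in> carrier \<M>\<^sub>3 \<Longrightarrow> [n] \<cdot>\<^bsub>\<M>\<^sub>3\<^esub> x = of_nat n \<odot>\<^bsub>\<M>\<^sub>3\<^esub> x"
  by (rule add_pow_eq_smult[OF module_M3])

lemma h3_rep_eq: "x \<in> carrier \<M>\<^sub>3 \<Longrightarrow> \<hh>\<^sub>3_rep x = P \<odot>\<^bsub>\<M>\<^sub>3\<^esub> x - \<delta>\<^sub>2 (\<hh>\<^sub>2 x)"
  unfolding h3_rep_def
  by (simp add: pow_M3 minus_M3 d2_carrier h2_carrier)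

lemma h3_rep_carrier: "x \<in> carrier \<M>\<^sub>3 \<Longrightarrow> \<hh>\<^sub>3_rep x \<in> carrier \<M>\<^sub>3"
  using minus_M3[of "P \<odot>\<^bsub>\<M>\<^sub>3\<^esub> x" "\<delta>\<^sub>2 (\<hh>\<^sub>2 x)"] d2_carrier[OF h2_carrier]
  by (metis Q.M.minus_closed Q.smult_closed UNIV_I class_ring_of_simps(1) h3_rep_eq)

lemma h3_rep_add:
  assumes "x \<in> carrier \<M>\<^sub>3" "y \<in> carrier \<M>\<^sub>3"
  shows "\<hh>\<^sub>3_rep (x + y) = \<hh>\<^sub>3_rep x + \<hh>\<^sub>3_rep y"
proof -
  have "x + y \<in> carrier \<M>\<^sub>3" using Q.M.a_closed[OF assms] by simp
  moreover have "P \<odot>\<^bsub>\<M>\<^sub>3\<^esub> (x + y) = P \<odot>\<^bsub>\<M>\<^sub>3\<^esub> x + P \<odot>\<^bsub>\<M>\<^sub>3\<^esub> y"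
    by (cases x; cases y) (simp add: algebra_simps)
  ultimately show ?thesis using assms by (simp add: h3_rep_eq d2_add h2_add)
qed

lemma h3_rep_smult:
  assumes "x \<in> carrier \<M>\<^sub>3"
  shows "\<hh>\<^sub>3_rep (r \<odot>\<^bsub>\<M>\<^sub>3\<^esub> x) = r \<odot>\<^bsub>\<M>\<^sub>3\<^esub> \<hh>\<^sub>3_rep x"
proof -
  have "r \<odot>\<^bsub>\<M>\<^sub>3\<^esub> x \<in> carrier \<M>\<^sub>3" using assms by simp
  then show ?thesis using assms
    by (cases x) (simp add: h3_rep_eq h2_eq d2_eq algebra_simps)
qed

text \<open>
  By the previous identity, \<open>h\<^sub>2 d\<^sub>2 y\<close> differs from \<open>p y\<close> by an element of the image of \<open>d\<^sub>1\<close>, which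
  \<open>d\<^sub>2\<close> annihilates. This is why \<open>h\<^sub>3\<close> is well-defined.
\<close>
lemma h3_rep_N:
  assumes "y \<in> UNIV \<times> const" shows "\<hh>\<^sub>3_rep (\<delta>\<^sub>2 y) = 0"
proof -
  obtain \<eta> x where y: "y = (\<eta>, x)" and x: "x \<in> const" using assms by auto
  have h: "h1 p y \<in> const" using x by (simp add: y h1_def mult_T_G_const const_closed)
  have "\<hh>\<^sub>2 (\<delta>\<^sub>2 y) = (P * \<eta>, P * x) - d1 p (h1 p y)"
    using d1_h1_h2_d2[OF x, of \<eta>] by (simp add: y eq_diff_eq add.commute)
  then have "\<delta>\<^sub>2 (\<hh>\<^sub>2 (\<delta>\<^sub>2 y)) = P \<odot>\<^bsub>\<M>\<^sub>3\<^esub> \<delta>\<^sub>2 y"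
    by (simp only: d2_diff d2_d1[OF h] d2_smult) (simp add: y)
  then show ?thesis using d2_carrier[OF assms] by (simp add: h3_rep_eq)
qed

lemma h3_d3:
  assumes x: "x \<in> carrier \<M>\<^sub>3" shows "\<hh>\<^sub>3 (\<delta>\<^sub>3 x) = \<hh>\<^sub>3_rep x"
proof -
  have "\<hh>\<^sub>3_rep z = \<hh>\<^sub>3_rep x" if "z \<in> \<delta>\<^sub>3 x" for z
  proof -
    have "\<exists>n\<in>\<N>. z = n \<oplus>\<^bsub>\<M>\<^sub>3\<^esub> x" using that by (auto simp: d3_def a_r_coset_def')
    then obtain y where y: "y \<in> UNIV \<times> const" "z = \<delta>\<^sub>2 y + x"
      unfolding carrier_M2 M3_ops by blast
    then show ?thesis using x d2_carrier[OF y(1)] h3_rep_N[OF y(1)] by (simp add: h3_rep_add)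
  qed
  moreover have "x \<in> \<delta>\<^sub>3 x" unfolding d3_eq by (rule Q.N.a_rcos_self[OF x])
  ultimately have "\<hh>\<^sub>3_rep ` \<delta>\<^sub>3 x = {\<hh>\<^sub>3_rep x}" by blast
  then show ?thesis by (simp add: h3_def)
qed

lemma h3_well_defined:
  "x \<in> carrier \<M>\<^sub>3 \<Longrightarrow> y \<in> carrier \<M>\<^sub>3 \<Longrightarrow> \<delta>\<^sub>3 x = \<delta>\<^sub>3 y \<Longrightarrow> \<hh>\<^sub>3_rep x = \<hh>\<^sub>3_rep y"
  by (metis h3_d3)

lemma module_M4: "module Z_G \<M>\<^sub>4"
  unfolding M4_eq by (rule Q.module_quot)

lemma M4_cases:
  assumes "X \<in> carrier \<M>\<^sub>4" obtains x where "x \<in> carrier \<M>\<^sub>3" "X = \<delta>\<^sub>3 x"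
  using assms exact(4) by blast

lemma hom_h3: "module_hom_of Z_G \<M>\<^sub>4 \<M>\<^sub>3 \<hh>\<^sub>3"
  unfolding module_hom_of_def
proof (intro conjI module_M4 module_M3 ballI)
  show "\<hh>\<^sub>3 \<in> carrier \<M>\<^sub>4 \<rightarrow> carrier \<M>\<^sub>3"
    by (auto elim!: M4_cases simp: h3_d3 h3_rep_carrier)
next
  fix X Y assume "X \<in> carrier \<M>\<^sub>4" "Y \<in> carrier \<M>\<^sub>4"
  then obtain x y where xy: "x \<in> carrier \<M>\<^sub>3" "X = \<delta>\<^sub>3 x" "y \<in> carrier \<M>\<^sub>3" "Y = \<delta>\<^sub>3 y"
    by (metis M4_cases)
  have "X \<oplus>\<^bsub>\<M>\<^sub>4\<^esub> Y = \<delta>\<^sub>3 (x \<oplus>\<^bsub>\<M>\<^sub>3\<^esub> y)"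
    using xy hom_d3 by (simp add: module_hom_of_def)
  moreover have "x \<oplus>\<^bsub>\<M>\<^sub>3\<^esub> y \<in> carrier \<M>\<^sub>3" using xy by blast
  ultimately show "\<hh>\<^sub>3 (X \<oplus>\<^bsub>\<M>\<^sub>4\<^esub> Y) = \<hh>\<^sub>3 X \<oplus>\<^bsub>\<M>\<^sub>3\<^esub> \<hh>\<^sub>3 Y"
    using xy by (simp add: h3_d3 h3_rep_add)
next
  fix r X assume "X \<in> carrier \<M>\<^sub>4"
  then obtain x where x: "x \<in> carrier \<M>\<^sub>3" "X = \<delta>\<^sub>3 x"
    by (metis M4_cases)
  then have "r \<odot>\<^bsub>\<M>\<^sub>4\<^esub> X = \<delta>\<^sub>3 (r \<odot>\<^bsub>\<M>\<^sub>3\<^esub> x)"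
    using hom_d3 by (simp add: module_hom_of_def)
  moreover have "r \<odot>\<^bsub>\<M>\<^sub>3\<^esub> x \<in> carrier \<M>\<^sub>3" using x by simp
  ultimately show "\<hh>\<^sub>3 (r \<odot>\<^bsub>\<M>\<^sub>4\<^esub> X) = r \<odot>\<^bsub>\<M>\<^sub>3\<^esub> \<hh>\<^sub>3 X"
    using x by (simp only: h3_d3 h3_rep_smult)
qed

lemma d3_h3:
  assumes "X \<in> carrier \<M>\<^sub>4" shows "\<delta>\<^sub>3 (\<hh>\<^sub>3 X) = [p] \<cdot>\<^bsub>\<M>\<^sub>4\<^esub> X"
proof -
  obtain x where x: "x \<in> carrier \<M>\<^sub>3" "X = \<delta>\<^sub>3 x" using assms by (rule M4_cases)
  have px: "P \<odot>\<^bsub>\<M>\<^sub>3\<^esub> x \<in> carrier \<M>\<^sub>3" using x by simp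
  have "\<delta>\<^sub>2 0 = 0" by (simp add: zero_prod_def d2_eq)
  then have "\<hh>\<^sub>3_rep x \<ominus>\<^bsub>\<M>\<^sub>3\<^esub> P \<odot>\<^bsub>\<M>\<^sub>3\<^esub> x = \<delta>\<^sub>2 (0 - \<hh>\<^sub>2 x)"
    by (subst minus_M3[OF h3_rep_carrier[OF x(1)] px]) (simp add: h3_rep_eq[OF x(1)] d2_diff del: diff_0)
  moreover have "0 - \<hh>\<^sub>2 x \<in> UNIV \<times> const" using h2_carrier[of x] const_closed(3) by (cases "\<hh>\<^sub>2 x") auto
  ultimately have "\<hh>\<^sub>3_rep x \<ominus>\<^bsub>\<M>\<^sub>3\<^esub> P \<odot>\<^bsub>\<M>\<^sub>3\<^esub> x \<in> \<N>" by (simp add: carrier_M2)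
  then have "\<delta>\<^sub>3 (\<hh>\<^sub>3_rep x) = \<delta>\<^sub>3 (P \<odot>\<^bsub>\<M>\<^sub>3\<^esub> x)"
    unfolding d3_eq using Q.coset_eq_iff[OF h3_rep_carrier[OF x(1)] px] by blast
  also have "\<dots> = P \<odot>\<^bsub>\<M>\<^sub>4\<^esub> X" using hom_d3 x by (simp add: module_hom_of_def)
  finally show ?thesis using x assms by (simp add: h3_d3 add_pow_eq_smult[OF module_M4])
qed

lemma homotopy_M1:
  "x \<in> carrier M1 \<Longrightarrow> h1 p (d1 p x) = [p] \<cdot>\<^bsub>M1\<^esub> x" for x :: "'g ZG"
  using add_pow_eq_smult[OF module_M1, of x p] by (simp add: carrier_M1 h1_d1)

lemma homotopy_M2:
  "x \<in> carrier M2 \<Longrightarrow> d1 p (h1 p x) \<oplus>\<^bsub>M2\<^esub> \<hh>\<^sub>2 (\<delta>\<^sub>2 x) = [p] \<cdot>\<^bsub>M2\<^esub> x" for x :: "'g ZG \<times> 'g ZG"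
  using add_pow_eq_smult[OF module_M2, of x p] by (cases x) (simp add: carrier_M2 d1_h1_h2_d2)

lemma homotopy_M3:
  "x \<in> carrier \<M>\<^sub>3 \<Longrightarrow> \<delta>\<^sub>2 (\<hh>\<^sub>2 x) \<oplus>\<^bsub>\<M>\<^sub>3\<^esub> \<hh>\<^sub>3 (\<delta>\<^sub>3 x) = [p] \<cdot>\<^bsub>\<M>\<^sub>3\<^esub> x"
  by (simp add: pow_M3 h3_d3 h3_rep_eq)

section \<open>Freeness over the integers\<close>

lemma card_parts:
  "card (UNIV <+> UNIV <+> H <+> H :: ('g + 'g + 'g + 'g) set) = 2 * p\<^sup>2 + 2 * p"
  "card (H <+> (UNIV - (H - {0})) <+> H <+> (H - {0})) = p\<^sup>2 + 2 * p"
proof -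
  have fin: "finite A" for A :: "'g set" by (rule finite_subset[OF subset_UNIV finite_G])
  show "card (UNIV <+> UNIV <+> H <+> H :: ('g + 'g + 'g + 'g) set) = 2 * p\<^sup>2 + 2 * p"
    by (simp add: card_Plus fin card_H card_G)
  have h: "card (H - {0}) = p - 1" by (simp add: card_H zero_H fin)
  have "card (UNIV - (H - {0})) = p\<^sup>2 - (p - 1)"
    by (subst card_Diff_subset) (use h card_G in \<open>simp_all add: fin\<close>)
  moreover have "p \<le> p\<^sup>2" using p_pos by (simp add: power2_eq_square)
  ultimately show "card (H <+> (UNIV - (H - {0})) <+> H <+> (H - {0})) = p\<^sup>2 + 2 * p"
    using p_pos by (simp add: card_Plus fin card_H h del: card_Diff_insert)
qed

lemma finite_Plus4: "finite (A <+> B <+> C <+> D)" for A B C D :: "'g set"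
  by (intro finite_Plus; rule finite_subset[OF subset_UNIV finite_G])

lemma has_coords_UNIV: "has_coords (UNIV :: 'g ZG set) Poly_Mapping.lookup UNIV"
  using has_coords_supp[of UNIV] by simp

lemma free_M1: "Z_free_of_rank (M1 :: ('g ZG, 'g ZG) module) 1"
proof -
  interpret K: module Z_G "M1 :: ('g ZG, 'g ZG) module" by (rule module_M1)
  show ?thesis unfolding Z_free_of_rank_def
    by (rule free_of_coords[where c = Poly_Mapping.lookup and I = "{0 :: 'g}"])
      (use K.M.a_group has_coords_const in \<open>simp_all add: carrier_M1 lookup_add\<close>)
qed

lemma free_M2: "Z_free_of_rank (M2 :: ('g ZG, 'g ZG \<times> 'g ZG) module) (p\<^sup>2 + 1)"
proof -
  interpret K: module Z_G "M2 :: ('g ZG, 'g ZG \<times> 'g ZG) module" by (rule module_M2)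
  show ?thesis unfolding Z_free_of_rank_def
  proof (rule free_of_coords)
    show "has_coords (carrier (add_monoid M2))
        (\<lambda>(x, y). case_sum (Poly_Mapping.lookup x) (Poly_Mapping.lookup y)) (UNIV <+> {0 :: 'g})"
      using has_coords_times[OF has_coords_UNIV has_coords_const] by (simp add: carrier_M2)
  qed (use K.M.a_group finite_G in \<open>auto simp: card_Plus card_G lookup_add\<close>)
qed

text \<open>Coordinates of quadruples: the coefficients of the four components.\<close>
abbreviation coeffs4 where
  "coeffs4 \<equiv> \<lambda>(a, b, c, d). case_sum (Poly_Mapping.lookup a)
    (case_sum (Poly_Mapping.lookup b) (case_sum (Poly_Mapping.lookup c) (Poly_Mapping.lookup d)))"

lemma has_coords_quadruples:
  assumes "has_coords S\<^sub>1 Poly_Mapping.lookup I\<^sub>1" "has_coords S\<^sub>2 Poly_Mapping.lookup I\<^sub>2"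
    "has_coords S\<^sub>3 Poly_Mapping.lookup I\<^sub>3" "has_coords S\<^sub>4 Poly_Mapping.lookup I\<^sub>4"
  shows "has_coords (S\<^sub>1 \<times> S\<^sub>2 \<times> S\<^sub>3 \<times> S\<^sub>4) coeffs4 (I\<^sub>1 <+> I\<^sub>2 <+> I\<^sub>3 <+> I\<^sub>4)"
  using has_coords_times[OF assms(1) has_coords_times[OF assms(2) has_coords_times[OF assms(3,4)]]]
  by (simp add: case_prod_unfold)

lemma coeffs4_add: "coeffs4 (x + y) i = coeffs4 x i + coeffs4 y i"
  for x y :: "'g ZG \<times> 'g ZG \<times> 'g ZG \<times> 'g ZG"
  by (cases x; cases y) (auto simp: lookup_add split: sum.split)

lemma free_M3: "Z_free_of_rank \<M>\<^sub>3 (2 * p\<^sup>2 + 2 * p)"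
  unfolding Z_free_of_rank_def
proof (rule free_of_coords)
  show "has_coords (carrier (add_monoid \<M>\<^sub>3)) coeffs4 (UNIV <+> UNIV <+> H <+> H)"
    using has_coords_quadruples[OF has_coords_UNIV has_coords_UNIV R3.has_coords_inv R4.has_coords_inv]
    by (simp add: carrier_M3)
qed (use Q.M.a_group finite_Plus4 in \<open>auto simp only: card_parts M3_ops coeffs4_add monoid.simps\<close>)

text \<open>
  A complement of the image of \<open>d\<^sub>2\<close> in \<open>M3\<close>, as a subgroup only (it is not stable under the group).
  The conditions on the first two components are those of the reduction above for \<open>\<sigma> = \<tau>\<^sub>1\<close> and
  \<open>\<rho> = \<tau>\<^sub>2\<close>. The last one takes care of the summand \<open>n T\<^sub>G\<close>, which \<open>d\<^sub>2\<close> adds to the last two components.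
\<close>
definition complement :: "('g ZG \<times> 'g ZG \<times> 'g ZG \<times> 'g ZG) set" where
  "complement = {a. \<forall>g. g \<notin> H \<longrightarrow> Poly_Mapping.lookup a g = 0} \<times>
    {b. \<forall>g. g \<notin> UNIV - (H - {0}) \<longrightarrow> Poly_Mapping.lookup b g = 0} \<times>
    R3.invs \<times> {d \<in> R4.invs. Poly_Mapping.lookup d 0 = 0}"

lemma complement_diff: "x \<in> complement \<Longrightarrow> y \<in> complement \<Longrightarrow> x - y \<in> complement"
  by (auto simp: complement_def lookup_minus R3.invs_def R4.invs_def right_diff_distrib)

lemma complement_add: "x \<in> complement \<Longrightarrow> y \<in> complement \<Longrightarrow> x + y \<in> complement"
  by (auto simp: complement_def lookup_add R3.invs_def R4.invs_def distrib_left)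

lemma complement_sub: "complement \<subseteq> carrier \<M>\<^sub>3"
  by (auto simp: complement_def carrier_M3)

lemma complement_inter:
  assumes "x \<in> complement" "x \<in> \<N>" shows "x = 0"
proof -
  obtain \<eta> y where x: "x = \<delta>\<^sub>2 (\<eta>, y)" and y: "y \<in> const" using assms(2) by (auto simp: carrier_M2)
  have "\<eta> \<in> const"
  proof (rule reduced_imp_const)
    show "generating_pair p \<tau>\<^sub>2 \<tau>\<^sub>1" by (rule swap.generating_pair_axioms)
  qed (use assms(1) in \<open>auto simp: x d2_eq complement_def\<close>)
  then have \<eta>: "\<eta> * t\<^sub>1 = 0" "\<eta> * t\<^sub>2 = 0" "\<eta> * T\<^sub>3 = P * \<eta>" "\<eta> * T\<^sub>4 = P * \<eta>" "P * \<eta> + y \<in> const"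
    using y const_t const_mult_cyc const_closed(1,2) by auto
  moreover have "Poly_Mapping.lookup (P * \<eta> + y) 0 = 0"
    using assms(1) \<eta>(4) by (simp add: x d2_eq complement_def)
  ultimately have "P * \<eta> + y = 0"
    using constD[OF \<eta>(5)] by (intro poly_mapping_eqI) simp
  then show ?thesis using \<eta> by (simp add: x d2_eq zero_prod_def)
qed

lemma complement_sum:
  assumes "x \<in> carrier \<M>\<^sub>3" shows "\<exists>y\<in>complement. x - y \<in> \<N>"
proof -
  obtain a b c d where x: "x = (a, b, c, d)" "c \<in> R3.invs" "d \<in> R4.invs"
    using assms by (auto simp: carrier_M3)
  obtain \<eta>\<^sub>1 where 1: "\<And>g. g \<notin> H \<Longrightarrow> Poly_Mapping.lookup (a - \<eta>\<^sub>1 * t\<^sub>1) g = 0"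
    using reduce_first[of a] by blast
  obtain \<eta>\<^sub>2 where 2: "\<eta>\<^sub>2 \<in> invs" "\<And>h. h \<in> H - {0} \<Longrightarrow> Poly_Mapping.lookup (b - \<eta>\<^sub>1 * t\<^sub>2 - \<eta>\<^sub>2 * t\<^sub>2) h = 0"
    using reduce_second[of "b - \<eta>\<^sub>1 * t\<^sub>2"] by blast
  define \<eta> where "\<eta> = - (\<eta>\<^sub>1 + \<eta>\<^sub>2)"
  \<comment> \<open>the multiple of \<open>T_G\<close> that cancels the coefficient of the last component at \<open>0\<close>\<close>
  define n where "n = of_int (Poly_Mapping.lookup (d - \<eta> * T\<^sub>4) 0) * (T_G :: 'g ZG)"
  have n: "n \<in> const" by (simp add: n_def mult_T_G_const)
  have "\<eta>\<^sub>2 * t\<^sub>1 = 0" using 2(1) by (simp add: invs_def right_diff_distrib mult.commute)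
  then have a: "a + \<eta> * t\<^sub>1 = a - \<eta>\<^sub>1 * t\<^sub>1" by (simp add: \<eta>_def algebra_simps)
  have b: "b + \<eta> * t\<^sub>2 = b - \<eta>\<^sub>1 * t\<^sub>2 - \<eta>\<^sub>2 * t\<^sub>2" by (simp add: \<eta>_def algebra_simps)
  have xy: "x - \<delta>\<^sub>2 (\<eta>, n) = (a - \<eta>\<^sub>1 * t\<^sub>1, b - \<eta>\<^sub>1 * t\<^sub>2 - \<eta>\<^sub>2 * t\<^sub>2, c - (\<eta> * T\<^sub>3 + n), d - (\<eta> * T\<^sub>4 + n))"
    unfolding a[symmetric] b[symmetric] by (simp add: x d2_eq)
  have "x - \<delta>\<^sub>2 (\<eta>, n) \<in> carrier \<M>\<^sub>3"
    using Q.M.minus_closed[OF assms d2_carrier, of "(\<eta>, n)"] minus_M3[OF assms d2_carrier, of "(\<eta>, n)"] n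
    by simp
  moreover have "Poly_Mapping.lookup (d - (\<eta> * T\<^sub>4 + n)) 0 = 0"
    by (simp only: n_def lookup_minus lookup_add lookup_of_int_mult lookup_T_G) simp
  ultimately have "x - \<delta>\<^sub>2 (\<eta>, n) \<in> complement"
    using 1 2(2) unfolding xy complement_def carrier_M3 by blast
  moreover have "x - (x - \<delta>\<^sub>2 (\<eta>, n)) \<in> \<N>" using n by (simp add: carrier_M2)
  ultimately show ?thesis by blast
qed

lemma free_M4: "Z_free_of_rank \<M>\<^sub>4 (p\<^sup>2 + 2 * p)"
  unfolding M4_eq
proof (rule Q.Z_free_of_rank_quot)
  show "has_coords complement coeffs4 (H <+> (UNIV - (H - {0})) <+> H <+> (H - {0}))"
    unfolding complement_def
    by (intro has_coords_quadruples has_coords_supp R3.has_coords_inv R4.has_coords_inv_0)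
  show "complement \<subseteq> carrier \<M>\<^sub>3" by (rule complement_sub)
  fix x y assume xy: "x \<in> complement" "y \<in> complement"
  then have "x \<in> carrier \<M>\<^sub>3" "y \<in> carrier \<M>\<^sub>3" using complement_sub by auto
  then show "x \<ominus>\<^bsub>\<M>\<^sub>3\<^esub> y \<in> complement" using complement_diff xy by (simp add: minus_M3)
  show "x \<oplus>\<^bsub>\<M>\<^sub>3\<^esub> y \<in> complement" using complement_add xy by simp
next
  fix x assume "x \<in> complement" "x \<in> \<N>"
  then show "x = \<zero>\<^bsub>\<M>\<^sub>3\<^esub>" using complement_inter by simp
next
  fix x assume x: "x \<in> carrier \<M>\<^sub>3"
  obtain y where y: "y \<in> complement" "x - y \<in> \<N>" using complement_sum[OF x] by blast
  then have "x \<ominus>\<^bsub>\<M>\<^sub>3\<^esub> y = x - y" using complement_sub by (intro minus_M3[OF x]) auto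
  then show "\<exists>y\<in>complement. x \<ominus>\<^bsub>\<M>\<^sub>3\<^esub> y \<in> \<N>" using y by metis
qed (simp_all only: card_parts finite_Plus4 M3_ops coeffs4_add)

end

theorem theorem1p3:
  fixes p :: nat and \<tau>\<^sub>1 \<tau>\<^sub>2 :: "'g::ab_group_add" and \<kappa>\<^sub>1 \<kappa>\<^sub>2 :: "'g ZG"
  assumes "prime p" and "odd p"
    and "(type_group :: 'g monoid) \<cong> integer_mod_group p \<times>\<times> integer_mod_group p"
    and "generate type_group {\<tau>\<^sub>1, \<tau>\<^sub>2} = (UNIV :: 'g set)"
    and "kappa_rel p \<tau>\<^sub>1 \<tau>\<^sub>2 \<kappa>\<^sub>1 \<kappa>\<^sub>2"
  shows
    \<comment> \<open>exactness\<close>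
    "(inj_on (d1 p) (carrier (M1 :: ('g ZG, 'g ZG) module)) \<and>
      d1 p ` carrier M1 = a_kernel M2 (M3 p \<tau>\<^sub>1 \<tau>\<^sub>2) (d2 p \<tau>\<^sub>1 \<tau>\<^sub>2) \<and>
      d2 p \<tau>\<^sub>1 \<tau>\<^sub>2 ` carrier M2 = a_kernel (M3 p \<tau>\<^sub>1 \<tau>\<^sub>2) (M4 p \<tau>\<^sub>1 \<tau>\<^sub>2) (d3 p \<tau>\<^sub>1 \<tau>\<^sub>2) \<and>
      d3 p \<tau>\<^sub>1 \<tau>\<^sub>2 ` carrier (M3 p \<tau>\<^sub>1 \<tau>\<^sub>2) = carrier (M4 p \<tau>\<^sub>1 \<tau>\<^sub>2)) \<and>
    \<comment> \<open>\<open>h3\<close> is well-defined\<close>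
     (\<forall>m\<in>carrier (M3 p \<tau>\<^sub>1 \<tau>\<^sub>2). \<forall>m'\<in>carrier (M3 p \<tau>\<^sub>1 \<tau>\<^sub>2).
        d3 p \<tau>\<^sub>1 \<tau>\<^sub>2 m = d3 p \<tau>\<^sub>1 \<tau>\<^sub>2 m' \<longrightarrow>
        h3_rep p \<tau>\<^sub>1 \<tau>\<^sub>2 \<kappa>\<^sub>1 \<kappa>\<^sub>2 m = h3_rep p \<tau>\<^sub>1 \<tau>\<^sub>2 \<kappa>\<^sub>1 \<kappa>\<^sub>2 m') \<and>
     (\<forall>m\<in>carrier (M3 p \<tau>\<^sub>1 \<tau>\<^sub>2).
        h3 p \<tau>\<^sub>1 \<tau>\<^sub>2 \<kappa>\<^sub>1 \<kappa>\<^sub>2 (d3 p \<tau>\<^sub>1 \<tau>\<^sub>2 m) = h3_rep p \<tau>\<^sub>1 \<tau>\<^sub>2 \<kappa>\<^sub>1 \<kappa>\<^sub>2 m) \<and>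
    \<comment> \<open>all maps are \<open>G\<close>-module maps\<close>
     (module_hom_of Z_G (M1 :: ('g ZG, 'g ZG) module) M2 (d1 p) \<and>
      module_hom_of Z_G M2 (M3 p \<tau>\<^sub>1 \<tau>\<^sub>2) (d2 p \<tau>\<^sub>1 \<tau>\<^sub>2) \<and>
      module_hom_of Z_G (M3 p \<tau>\<^sub>1 \<tau>\<^sub>2) (M4 p \<tau>\<^sub>1 \<tau>\<^sub>2) (d3 p \<tau>\<^sub>1 \<tau>\<^sub>2) \<and>
      module_hom_of Z_G M2 (M1 :: ('g ZG, 'g ZG) module) (h1 p) \<and>
      module_hom_of Z_G (M3 p \<tau>\<^sub>1 \<tau>\<^sub>2) M2 (h2 p \<kappa>\<^sub>1 \<kappa>\<^sub>2) \<and>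
      module_hom_of Z_G (M4 p \<tau>\<^sub>1 \<tau>\<^sub>2) (M3 p \<tau>\<^sub>1 \<tau>\<^sub>2) (h3 p \<tau>\<^sub>1 \<tau>\<^sub>2 \<kappa>\<^sub>1 \<kappa>\<^sub>2)) \<and>
    \<comment> \<open>the homotopy condition\<close>
     ((\<forall>x\<in>carrier (M1 :: ('g ZG, 'g ZG) module). h1 p (d1 p x) = [p] \<cdot>\<^bsub>M1\<^esub> x) \<and>
      (\<forall>x\<in>carrier M2.
         d1 p (h1 p x) \<oplus>\<^bsub>M2\<^esub> h2 p \<kappa>\<^sub>1 \<kappa>\<^sub>2 (d2 p \<tau>\<^sub>1 \<tau>\<^sub>2 x) = [p] \<cdot>\<^bsub>M2\<^esub> x) \<and>
      (\<forall>x\<in>carrier (M3 p \<tau>\<^sub>1 \<tau>\<^sub>2).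
         d2 p \<tau>\<^sub>1 \<tau>\<^sub>2 (h2 p \<kappa>\<^sub>1 \<kappa>\<^sub>2 x) \<oplus>\<^bsub>M3 p \<tau>\<^sub>1 \<tau>\<^sub>2\<^esub>
           h3 p \<tau>\<^sub>1 \<tau>\<^sub>2 \<kappa>\<^sub>1 \<kappa>\<^sub>2 (d3 p \<tau>\<^sub>1 \<tau>\<^sub>2 x) = [p] \<cdot>\<^bsub>M3 p \<tau>\<^sub>1 \<tau>\<^sub>2\<^esub> x) \<and>
      (\<forall>x\<in>carrier (M4 p \<tau>\<^sub>1 \<tau>\<^sub>2).
         d3 p \<tau>\<^sub>1 \<tau>\<^sub>2 (h3 p \<tau>\<^sub>1 \<tau>\<^sub>2 \<kappa>\<^sub>1 \<kappa>\<^sub>2 x) = [p] \<cdot>\<^bsub>M4 p \<tau>\<^sub>1 \<tau>\<^sub>2\<^esub> x)) \<and>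
    \<comment> \<open>freeness over the integers\<close>
     (Z_free_of_rank (M1 :: ('g ZG, 'g ZG) module) 1 \<and>
      Z_free_of_rank (M2 :: ('g ZG, 'g ZG \<times> 'g ZG) module) (p\<^sup>2 + 1) \<and>
      Z_free_of_rank (M3 p \<tau>\<^sub>1 \<tau>\<^sub>2) (2 * p\<^sup>2 + 2 * p) \<and>
      Z_free_of_rank (M4 p \<tau>\<^sub>1 \<tau>\<^sub>2) (p\<^sup>2 + 2 * p))"
proof -
  have "p \<noteq> 2" using assms(2) by auto
  then have "p \<ge> 3" using prime_ge_2_nat[OF assms(1)] by simp
  then interpret resolution_setup p \<tau>\<^sub>1 \<tau>\<^sub>2 \<kappa>\<^sub>1 \<kappa>\<^sub>2
    using assms by (intro resolution_setup.intro resolution_setup_axioms.intro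
        generating_pair_of_generators) auto
  show ?thesis
    by (intro conjI ballI impI exact h3_well_defined h3_d3 hom_d1 hom_d2 hom_d3 hom_h1 hom_h2 hom_h3
        homotopy_M1 homotopy_M2 homotopy_M3 d3_h3 free_M1 free_M2 free_M3 free_M4)
qed

end
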